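(* Let $0<q<1$, let $\alpha',\alpha''\in\mathbb{R}\setminus\{0\}$, and put $\gamma=\alpha''^{2}\alpha'^{-2}$, $\nu=|\alpha''|^{-1}$, $\beta=q^{2}\nu$. Let $\Box_{SU_q(2)}=\star\,\mathrm{d}\star\mathrm{d}:\mathcal{A}(SU_q(2))\to\mathcal{A}(SU_q(2))$ be the Laplacian of the 3D calculus, and for $n\in\mathbb{Z}$ let $\Box_{D_0}:\mathcal{L}^{(0)}_n\to\mathcal{L}^{(0)}_n$ be the Laplacian on $S^2_q$ gauged by the monopole connection (all defined in the context). Then for every $n\in\mathbb{Z}$ and every $\phi\in\mathcal{L}^{(0)}_n$, $$q^{2n}\,\Box_{D_0}\phi=\Box_{SU_q(2)}\phi+\gamma\,X_z\triangleright(X_z\triangleright\phi).$$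
   Context: Let $0<q<1$ and $[x]=(q^x-q^{-x})/(q-q^{-1})$. Algebra. $\mathcal{A}(SU_q(2))$ is the unital $*$-algebra generated by $a,c$ with $ac=qca$, $ac^*=qc^*a$, $cc^*=c^*c$, $a^*a+c^*c=aa^*+q^2cc^*=1$. The Hopf algebra $\mathcal{U}_q(\mathfrak{su}(2))$ generated by $K^{\pm1},E,F$, with coproduct $\Delta K^{\pm1}=K^{\pm1}\otimes K^{\pm1}$, $\Delta E=E\otimes K+K^{-1}\otimes E$, $\Delta F=F\otimes K+K^{-1}\otimes F$, acts on it from the left (with $X\triangleright(xy)=(X_{(1)}\triangleright x)(X_{(2)}\triangleright y)$, $X\triangleright 1=\varepsilon(X)1$, $\varepsilon(K)=1$, $\varepsilon(E)=\varepsilon(F)=0$) by $K\triangleright a=q^{-1/2}a$, $K\triangleright c=q^{-1/2}c$, $K\triangleright a^*=q^{1/2}a^*$, $K\triangleright c^*=q^{1/2}c^*$; $E\triangleright a=-qc^*$, $E\triangleright c=a^*$, $E\triangleright a^*=E\triangleright c^*=0$; $F\triangleright a^*=c$, $F\triangleright c^*=-q^{-1}a$, $F\triangleright a=F\triangleright c=0$. Put $\mathcal{L}^{(0)}_n=\{x: K\triangleright x=q^{n/2}x\}$, $\mathcal{A}(S^2_q)=\mathcal{L}^{(0)}_0$, and $X_-=q^{-1/2}FK$, $X_+=q^{1/2}EK$, $X_z=(1-K^4)/(1-q^{-2})$. 3D calculus. $\Omega(SU_q(2))$ is the graded differential algebra which is a free left $\mathcal{A}(SU_q(2))$-module with basis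 $1$; $\omega_-,\omega_+,\omega_z$; $\omega_-\wedge\omega_+,\ \omega_+\wedge\omega_z,\ \omega_z\wedge\omega_-$; $\omega_-\wedge\omega_+\wedge\omega_z$, with $\omega_z\phi=q^{2n}\phi\,\omega_z$, $\omega_\pm\phi=q^n\phi\,\omega_\pm$ for $\phi\in\mathcal{L}^{(0)}_n$; $\omega_\pm\wedge\omega_\pm=\omega_z\wedge\omega_z=0$, $\omega_-\wedge\omega_++q^{-2}\omega_+\wedge\omega_-=0$, $\omega_z\wedge\omega_-+q^4\omega_-\wedge\omega_z=0$, $\omega_z\wedge\omega_++q^{-4}\omega_+\wedge\omega_z=0$; and $\mathrm{d}$ the graded derivation with $\mathrm{d}^2=0$, $\mathrm{d}x=(X_+\triangleright x)\omega_++(X_-\triangleright x)\omega_-+(X_z\triangleright x)\omega_z$, $\mathrm{d}\omega_z=-\omega_-\wedge\omega_+$, $\mathrm{d}\omega_+=q^2(1+q^2)\omega_z\wedge\omega_+$, $\mathrm{d}\omega_-=-(1+q^{-2})\omega_z\wedge\omega_-$. Hodge structure on $\Omega(SU_q(2))$: the left $\mathcal{A}(SU_q(2))$-linear map $\star:\Omega^k\to\Omega^{3-k}$ with $\star(1)=\alpha'\omega_-\wedge\omega_+\wedge\omega_z$, $\star(\omega_-)=-\alpha'\beta q^{-6}\omega_z\wedge\omega_-$, $\star(\omega_+)=-\alpha'\nu\,\omega_+\wedge\omega_z$, $\star(\omega_z)=-\alpha'\gamma\,\omega_-\wedge\omega_+$, $\star(\omega_-\wedge\omega_+)=-\alpha'^{-1}\gamma^{-1}\omega_z$,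 $\star(\omega_+\wedge\omega_z)=-\alpha'^{-1}\nu^{-1}\omega_+$, $\star(\omega_z\wedge\omega_-)=-\alpha'^{-1}\beta^{-1}q^6\omega_-$, $\star(\omega_-\wedge\omega_+\wedge\omega_z)=\alpha'^{-1}$. It defines $\Box_{SU_q(2)}x=\star\,\mathrm{d}\star\mathrm{d}x$ for $x\in\mathcal{A}(SU_q(2))$. 2D calculus on $S^2_q$. $\Omega(S^2_q)\subset\Omega(SU_q(2))$ is the differential subalgebra with $\Omega^0=\mathcal{L}^{(0)}_0$, $\Omega^1=\mathcal{L}^{(0)}_{-2}\omega_-\oplus\mathcal{L}^{(0)}_2\omega_+$, $\Omega^2=\mathcal{L}^{(0)}_0\,\omega_-\wedge\omega_+$. Its Hodge structure is the left $\mathcal{A}(S^2_q)$-linear map $\star:\Omega^k(S^2_q)\to\Omega^{2-k}(S^2_q)$ with $\star(1)=i\alpha''\omega_-\wedge\omega_+$, $\star(x\omega_-)=i\frac{|\alpha''|}{\alpha''}x\omega_-$, $\star(y\omega_+)=-i\frac{|\alpha''|}{\alpha''}y\omega_+$, $\star(i\omega_-\wedge\omega_+)=\alpha''^{-1}$ ($x\in\mathcal{L}^{(0)}_{-2}$, $y\in\mathcal{L}^{(0)}_2$). Line bundles. For $n\in\mathbb{Z}$ let $|\Psi^{(n)}\rangle$ be the column with entries, $\mu=0,\dots,|n|$: for $n\ge0$, $|\Psi^{(n)}\rangle_\mu=\sqrt{\beta_{n,\mu}}\,c^{*\mu}a^{*\,n-\mu}$ with $\beta_{n,0}=1$, $\beta_{n,\mu}=q^{2\mu}\prod_{j=0}^{\mu-1}\frac{1-q^{-2(n-j)}}{1-q^{-2(j+1)}}$;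 for $n\le0$, $|\Psi^{(n)}\rangle_\mu=\sqrt{\alpha_{n,\mu}}\,c^{|n|-\mu}a^{\mu}$ with $\alpha_{n,0}=1$, $\alpha_{n,\mu}=\prod_{j=0}^{|n|-\mu-1}\frac{1-q^{2(|n|-j)}}{1-q^{2(j+1)}}$. Its entries lie in $\mathcal{L}^{(0)}_n$; $\langle\Psi^{(n)}|$ is the row of adjoint entries; $\langle\Psi^{(n)}|\Psi^{(n)}\rangle=1$; $\mathfrak{p}^{(n)}=|\Psi^{(n)}\rangle\langle\Psi^{(n)}|$ is a projection with entries in $\mathcal{A}(S^2_q)$. Put $\mathcal{E}^{(0)}_n=\mathcal{A}(S^2_q)^{|n|+1}\mathfrak{p}^{(n)}$ (row vectors) and identify $\mathcal{E}^{(k)}_n=\Omega^k(S^2_q)\otimes_{\mathcal{A}(S^2_q)}\mathcal{E}^{(0)}_n$ with the rows $\langle\sigma|\in\Omega^k(S^2_q)^{|n|+1}$ satisfying $\langle\sigma|\mathfrak{p}^{(n)}=\langle\sigma|$. The map $\phi\mapsto\langle\sigma_\phi|=\phi\langle\Psi^{(n)}|$ is an isomorphism $\mathcal{L}^{(0)}_n\simeq\mathcal{E}^{(0)}_n$ with inverse $\langle\sigma|\mapsto\langle\sigma|\Psi^{(n)}\rangle$. Gauged Laplacian. The monopole (Grassmann) connection is $\nabla_0:\mathcal{E}_n^{(k)}\to\mathcal{E}_n^{(k+1)}$, $\nabla_0\langle\sigma|=(\mathrm{d}\langle\sigma|)\mathfrak{p}^{(n)}$ ($\mathrm{d}$ and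 the Hodge map $\star$ of $\Omega(S^2_q)$ applied entrywise), and $\Box_{D_0}\phi=\big(\star\nabla_0\star\nabla_0\langle\sigma_\phi|\big)|\Psi^{(n)}\rangle$ for $\phi\in\mathcal{L}^{(0)}_n$. *)

theory Defs
  imports Complex_Main "HOL-Library.Poly_Mapping"
begin

section \<open>Complex algebras\<close>

locale complex_algebra = vector_space scale
  for scale :: "complex \<Rightarrow> 'a::ring_1 \<Rightarrow> 'a" +
  assumes scale_mult_left: "scale z x * y = scale z (x * y)"
    and scale_mult_right: "x * scale z y = scale z (x * y)"

locale complex_star_algebra = complex_algebra scale
  for scale :: "complex \<Rightarrow> 'a::ring_1 \<Rightarrow> 'a" +
  fixes adj :: "'a \<Rightarrow> 'a"
  assumes adj_adj: "adj (adj x) = x"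
    and adj_add: "adj (x + y) = adj x + adj y"
    and adj_scale: "adj (scale z x) = scale (cnj z) (adj x)"
    and adj_mult: "adj (x * y) = adj y * adj x"

section \<open>The defining presentation of the coordinate algebra of quantum SU(2)\<close>

text \<open>The free unital \<open>*\<close>-algebra on \<open>a, c\<close> is the free algebra on \<open>a, a*, c, c*\<close>, i.e. the
  monoid algebra over \<open>complex\<close> of the free monoid of words.\<close>

datatype letter = La | Las | Lc | Lcs

datatype word = Word (letters: "letter list")

instantiation word :: monoid_add
begin
definition "0 = Word []"
definition "v + w = Word (letters v @ letters w)"
instance
  by standard (simp_all add: zero_word_def plus_word_def)
end

type_synonym free_alg = "word \<Rightarrow>\<^sub>0 complex"

definition fgen :: "letter \<Rightarrow> free_alg" where
  "fgen l = Poly_Mapping.single (Word [l]) 1"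

definition fconst :: "complex \<Rightarrow> free_alg" where
  "fconst z = Poly_Mapping.single 0 z"

text \<open>The first five relators are the stated relations; the last two are the adjoints of the
  first two (the remaining three relators are, up to sign, self-adjoint).\<close>

definition relators :: "real \<Rightarrow> free_alg set" where
  "relators q = (let a = fgen La; as = fgen Las; c = fgen Lc; cs = fgen Lcs; qq = fconst (of_real q) in
     {a * c - qq * c * a,
      a * cs - qq * cs * a,
      c * cs - cs * c,
      as * a + cs * c - 1,
      a * as + qq ^ 2 * c * cs - 1,
      cs * as - qq * as * cs,
      c * as - qq * as * c})"

inductive_set relation_ideal :: "real \<Rightarrow> free_alg set" for q :: real where
  zero: "0 \<in> relation_ideal q"
| relator: "r \<in> relators q \<Longrightarrow> r \<in> relation_ideal q"
| add: "x \<in> relation_ideal q \<Longrightarrow> y \<in> relation_ideal q \<Longrightarrow> x + y \<in> relation_ideal q"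
| mult: "x \<in> relation_ideal q \<Longrightarrow> u * x * v \<in> relation_ideal q"

section \<open>The data: algebra, action, three-dimensional calculus\<close>

text \<open>\<open>'a\<close> is \<open>A(SU\<^sub>q(2))\<close> and \<open>'w\<close> is \<open>\<Omega>(SU\<^sub>q(2))\<close>, whose product is the wedge product;
  \<open>emb\<close> is the inclusion \<open>A(SU\<^sub>q(2)) = \<Omega>\<^sup>0 \<subseteq> \<Omega>\<close>. The maps \<open>actK, actKi, actE, actF\<close> are the left
  actions of \<open>K, K\<^sup>-\<^sup>1, E, F\<close>.\<close>

record ('a, 'w) suq2_data =
  scaleA :: "complex \<Rightarrow> 'a \<Rightarrow> 'a"
  adj :: "'a \<Rightarrow> 'a"
  gen_a :: 'a
  gen_c :: 'a
  actK :: "'a \<Rightarrow> 'a"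
  actKi :: "'a \<Rightarrow> 'a"
  actE :: "'a \<Rightarrow> 'a"
  actF :: "'a \<Rightarrow> 'a"
  scaleW :: "complex \<Rightarrow> 'w \<Rightarrow> 'w"
  emb :: "'a \<Rightarrow> 'w"
  om_m :: 'w
  om_p :: 'w
  om_z :: 'w
  dd :: "'w \<Rightarrow> 'w"

text \<open>This locale has no assumptions; it only fixes \<open>q\<close> and the data for the definitions below.\<close>

locale suq2_ops =
  fixes q :: real and S :: "('a::ring_1, 'w::ring_1) suq2_data"
begin

abbreviation smA :: "complex \<Rightarrow> 'a \<Rightarrow> 'a" (infixr \<open>*\<^sub>A\<close> 75) where "smA \<equiv> scaleA S"
abbreviation smW :: "complex \<Rightarrow> 'w \<Rightarrow> 'w" (infixr \<open>*\<^sub>W\<close> 75) where "smW \<equiv> scaleW S"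
abbreviation star :: "'a \<Rightarrow> 'a" where "star \<equiv> adj S"
abbreviation a :: 'a where "a \<equiv> gen_a S"
abbreviation c :: 'a where "c \<equiv> gen_c S"
abbreviation K :: "'a \<Rightarrow> 'a" where "K \<equiv> actK S"
abbreviation Kinv :: "'a \<Rightarrow> 'a" where "Kinv \<equiv> actKi S"
abbreviation E :: "'a \<Rightarrow> 'a" where "E \<equiv> actE S"
abbreviation F :: "'a \<Rightarrow> 'a" where "F \<equiv> actF S"
abbreviation \<iota> :: "'a \<Rightarrow> 'w" where "\<iota> \<equiv> emb S"
abbreviation \<omega>m :: 'w where "\<omega>m \<equiv> om_m S"
abbreviation \<omega>p :: 'w where "\<omega>p \<equiv> om_p S"
abbreviation \<omega>z :: 'w where "\<omega>z \<equiv> om_z S"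
abbreviation d :: "'w \<Rightarrow> 'w" where "d \<equiv> dd S"

fun letter_val :: "letter \<Rightarrow> 'a" where
  "letter_val La = a"
| "letter_val Las = star a"
| "letter_val Lc = c"
| "letter_val Lcs = star c"

definition eval_free :: "free_alg \<Rightarrow> 'a" where
  "eval_free p = (\<Sum>w \<in> Poly_Mapping.keys p.
     Poly_Mapping.lookup p w *\<^sub>A prod_list (map letter_val (letters w)))"

text \<open>\<open>L n\<close> is \<open>\<L>\<^sup>(\<^sup>0\<^sup>)\<^sub>n\<close>; in particular \<open>L 0\<close> is \<open>A(S\<^sup>2\<^sub>q)\<close>.\<close>

definition L :: "int \<Rightarrow> 'a set" where
  "L n = {x. K x = complex_of_real (q powr (real_of_int n / 2)) *\<^sub>A x}"

definition Xm :: "'a \<Rightarrow> 'a" where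
  "Xm x = complex_of_real (q powr (- 1 / 2)) *\<^sub>A F (K x)"

definition Xp :: "'a \<Rightarrow> 'a" where
  "Xp x = complex_of_real (q powr (1 / 2)) *\<^sub>A E (K x)"

definition Xz :: "'a \<Rightarrow> 'a" where
  "Xz x = complex_of_real (1 / (1 - q powi (- 2))) *\<^sub>A (x - K (K (K (K x))))"

definition frame_comb :: "'a \<times> 'a \<times> 'a \<times> 'a \<times> 'a \<times> 'a \<times> 'a \<times> 'a \<Rightarrow> 'w" where
  "frame_comb = (\<lambda>(x0, xm, xp, xz, xmp, xpz, xzm, xv).
     \<iota> x0 + \<iota> xm * \<omega>m + \<iota> xp * \<omega>p + \<iota> xz * \<omega>z
     + \<iota> xmp * (\<omega>m * \<omega>p) + \<iota> xpz * (\<omega>p * \<omega>z) + \<iota> xzm * (\<omega>z * \<omega>m)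
     + \<iota> xv * (\<omega>m * \<omega>p * \<omega>z))"

definition forms :: "nat \<Rightarrow> 'w set" where
  "forms k = {frame_comb (x0, xm, xp, xz, xmp, xpz, xzm, xv) | x0 xm xp xz xmp xpz xzm xv.
     (k \<noteq> 0 \<longrightarrow> x0 = 0) \<and>
     (k \<noteq> 1 \<longrightarrow> xm = 0 \<and> xp = 0 \<and> xz = 0) \<and>
     (k \<noteq> 2 \<longrightarrow> xmp = 0 \<and> xpz = 0 \<and> xzm = 0) \<and>
     (k \<noteq> 3 \<longrightarrow> xv = 0)}"

end

section \<open>The axioms\<close>

text \<open>\<open>A(SU\<^sub>q(2))\<close> is characterised up to isomorphism by its presentation: the generators generate,
  and exactly the consequences of the relations hold between them.\<close>

locale suq2_algebra = suq2_ops q S + complex_star_algebra "scaleA S" "adj S"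
  for q :: real and S :: "('a::ring_1, 'w::ring_1) suq2_data" +
  assumes q_pos: "0 < q" and q_less_1: "q < 1"
    and generated: "range eval_free = UNIV"
    and presented: "eval_free p = 0 \<longleftrightarrow> p \<in> relation_ideal q"

text \<open>In particular the defining relations hold.\<close>

context suq2_algebra
begin

lemma eval_free_superset:
  assumes "finite A" "Poly_Mapping.keys p \<subseteq> A"
  shows "eval_free p = (\<Sum>w\<in>A. Poly_Mapping.lookup p w *\<^sub>A prod_list (map letter_val (letters w)))"
  unfolding eval_free_def using assms
  by (intro sum.mono_neutral_left) (auto simp: in_keys_iff scale_zero_left)

lemma eval_free_add: "eval_free (x + y) = eval_free x + eval_free y"
proof -
  let ?A = "Poly_Mapping.keys x \<union> Poly_Mapping.keys y"
  have "Poly_Mapping.keys (x + y) \<subseteq> ?A" by (rule Poly_Mapping.keys_add)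
  then show ?thesis
    by (simp add: eval_free_superset[of ?A] lookup_add scale_left_distrib sum.distrib)
qed

lemma eval_free_diff: "eval_free (x - y) = eval_free x - eval_free y"
  using eval_free_add[of "x - y" y] by simp

lemma eval_free_single:
  "eval_free (Poly_Mapping.single w z) = z *\<^sub>A prod_list (map letter_val (letters w))"
  by (simp add: eval_free_superset[of "{w}"])

lemma relations:
  shows "a * c = complex_of_real q *\<^sub>A (c * a)"
    and "a * star c = complex_of_real q *\<^sub>A (star c * a)"
    and "c * star c = star c * c"
    and "star a * a + star c * c = 1"
    and "a * star a + complex_of_real (q\<^sup>2) *\<^sub>A (c * star c) = 1"
proof -
  have r: "eval_free r = 0" if "r \<in> relators q" for r
    using that presented relation_ideal.relator by blast
  note s = eval_free_diff eval_free_add eval_free_single mult_single fgen_def fconst_def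
    plus_word_def zero_word_def power2_eq_square single_one[symmetric]
  show "a * c = complex_of_real q *\<^sub>A (c * a)"
    using r[of "fgen La * fgen Lc - fconst (of_real q) * fgen Lc * fgen La"]
    by (simp add: relators_def s del: single_one)
  show "a * star c = complex_of_real q *\<^sub>A (star c * a)"
    using r[of "fgen La * fgen Lcs - fconst (of_real q) * fgen Lcs * fgen La"]
    by (simp add: relators_def s del: single_one)
  show "c * star c = star c * c"
    using r[of "fgen Lc * fgen Lcs - fgen Lcs * fgen Lc"]
    by (simp add: relators_def s del: single_one)
  show "star a * a + star c * c = 1"
    using r[of "fgen Las * fgen La + fgen Lcs * fgen Lc - 1"]
    by (simp add: relators_def s del: single_one)
  show "a * star a + complex_of_real (q\<^sup>2) *\<^sub>A (c * star c) = 1"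
    using r[of "fgen La * fgen Las + fconst (of_real q) ^ 2 * fgen Lc * fgen Lcs - 1"]
    by (simp add: relators_def s del: single_one)
qed

end

text \<open>The left action, given by the algebra maps \<open>K\<close>, \<open>K\<^sup>-\<^sup>1\<close> and the twisted derivations \<open>E\<close>, \<open>F\<close>
  dictated by the coproduct.\<close>

locale suq2_action = suq2_algebra q S
  for q :: real and S :: "('a::ring_1, 'w::ring_1) suq2_data" +
  assumes K_linear: "Vector_Spaces.linear (scaleA S) (scaleA S) K"
    and E_linear: "Vector_Spaces.linear (scaleA S) (scaleA S) E"
    and F_linear: "Vector_Spaces.linear (scaleA S) (scaleA S) F"
    and K_Kinv: "K (Kinv x) = x" and Kinv_K: "Kinv (K x) = x"
    and K_mult: "K (x * y) = K x * K y"
    and E_mult: "E (x * y) = E x * K y + Kinv x * E y"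
    and F_mult: "F (x * y) = F x * K y + Kinv x * F y"
    and K_one: "K 1 = 1" and E_one: "E 1 = 0" and F_one: "F 1 = 0"
    and K_a: "K a = complex_of_real (q powr (- 1 / 2)) *\<^sub>A a"
    and K_c: "K c = complex_of_real (q powr (- 1 / 2)) *\<^sub>A c"
    and K_as: "K (star a) = complex_of_real (q powr (1 / 2)) *\<^sub>A star a"
    and K_cs: "K (star c) = complex_of_real (q powr (1 / 2)) *\<^sub>A star c"
    and E_a: "E a = complex_of_real (- q) *\<^sub>A star c"
    and E_c: "E c = star a"
    and E_as: "E (star a) = 0" and E_cs: "E (star c) = 0"
    and F_as: "F (star a) = c"
    and F_cs: "F (star c) = complex_of_real (- (1 / q)) *\<^sub>A a"
    and F_a: "F a = 0" and F_c: "F c = 0"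

text \<open>Bijectivity of \<open>frame_comb\<close> says that \<open>\<Omega>(SU\<^sub>q(2))\<close> is a free left module on the eight
  listed basis forms.\<close>

locale suq2_calculus = suq2_action q S + W: complex_algebra "scaleW S"
  for q :: real and S :: "('a::ring_1, 'w::ring_1) suq2_data" +
  assumes emb_linear: "Vector_Spaces.linear (scaleA S) (scaleW S) \<iota>"
    and emb_one: "\<iota> 1 = 1"
    and emb_mult: "\<iota> (x * y) = \<iota> x * \<iota> y"
    and free: "bij frame_comb"
    and forms_mult: "v \<in> forms k \<Longrightarrow> w \<in> forms l \<Longrightarrow> v * w \<in> forms (k + l)"
    and wz_comm: "\<phi> \<in> L n \<Longrightarrow> \<omega>z * \<iota> \<phi> = complex_of_real (q powi (2 * n)) *\<^sub>W (\<iota> \<phi> * \<omega>z)"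
    and wm_comm: "\<phi> \<in> L n \<Longrightarrow> \<omega>m * \<iota> \<phi> = complex_of_real (q powi n) *\<^sub>W (\<iota> \<phi> * \<omega>m)"
    and wp_comm: "\<phi> \<in> L n \<Longrightarrow> \<omega>p * \<iota> \<phi> = complex_of_real (q powi n) *\<^sub>W (\<iota> \<phi> * \<omega>p)"
    and wm_wm: "\<omega>m * \<omega>m = 0" and wp_wp: "\<omega>p * \<omega>p = 0" and wz_wz: "\<omega>z * \<omega>z = 0"
    and wm_wp: "\<omega>m * \<omega>p + complex_of_real (q powi (- 2)) *\<^sub>W (\<omega>p * \<omega>m) = 0"
    and wz_wm: "\<omega>z * \<omega>m + complex_of_real (q ^ 4) *\<^sub>W (\<omega>m * \<omega>z) = 0"
    and wz_wp: "\<omega>z * \<omega>p + complex_of_real (q powi (- 4)) *\<^sub>W (\<omega>p * \<omega>z) = 0"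
    and d_linear: "Vector_Spaces.linear (scaleW S) (scaleW S) d"
    and d_degree: "w \<in> forms k \<Longrightarrow> d w \<in> forms (k + 1)"
    and d_Leibniz: "v \<in> forms k \<Longrightarrow> d (v * w) = d v * w + (- 1) ^ k * (v * d w)"
    and d_d: "d (d w) = 0"
    and d_emb: "d (\<iota> x) = \<iota> (Xp x) * \<omega>p + \<iota> (Xm x) * \<omega>m + \<iota> (Xz x) * \<omega>z"
    and d_wz: "d \<omega>z = - (\<omega>m * \<omega>p)"
    and d_wp: "d \<omega>p = complex_of_real (q\<^sup>2 * (1 + q\<^sup>2)) *\<^sub>W (\<omega>z * \<omega>p)"
    and d_wm: "d \<omega>m = complex_of_real (- (1 + q powi (- 2))) *\<^sub>W (\<omega>z * \<omega>m)"

section \<open>Hodge maps, line bundles, Laplacians\<close>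

context suq2_ops
begin

text \<open>The left-linear Hodge map, written on the coordinates in the free basis.\<close>

definition hodge_SU :: "real \<Rightarrow> real \<Rightarrow> real \<Rightarrow> real \<Rightarrow> 'w \<Rightarrow> 'w" where
  "hodge_SU \<alpha>' \<beta> \<gamma> \<nu> w = (case inv frame_comb w of (x0, xm, xp, xz, xmp, xpz, xzm, xv) \<Rightarrow>
     \<iota> x0 * (complex_of_real \<alpha>' *\<^sub>W (\<omega>m * \<omega>p * \<omega>z))
     + \<iota> xm * (complex_of_real (- (\<alpha>' * \<beta> * q powi (- 6))) *\<^sub>W (\<omega>z * \<omega>m))
     + \<iota> xp * (complex_of_real (- (\<alpha>' * \<nu>)) *\<^sub>W (\<omega>p * \<omega>z))
     + \<iota> xz * (complex_of_real (- (\<alpha>' * \<gamma>)) *\<^sub>W (\<omega>m * \<omega>p))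
     + \<iota> xmp * (complex_of_real (- (inverse \<alpha>' * inverse \<gamma>)) *\<^sub>W \<omega>z)
     + \<iota> xpz * (complex_of_real (- (inverse \<alpha>' * inverse \<nu>)) *\<^sub>W \<omega>p)
     + \<iota> xzm * (complex_of_real (- (inverse \<alpha>' * inverse \<beta> * q ^ 6)) *\<^sub>W \<omega>m)
     + \<iota> xv * (complex_of_real (inverse \<alpha>') *\<^sub>W 1))"

definition box_SU :: "real \<Rightarrow> real \<Rightarrow> real \<Rightarrow> real \<Rightarrow> 'a \<Rightarrow> 'a" where
  "box_SU \<alpha>' \<beta> \<gamma> \<nu> x =
     inv \<iota> (hodge_SU \<alpha>' \<beta> \<gamma> \<nu> (d (hodge_SU \<alpha>' \<beta> \<gamma> \<nu> (d (\<iota> x)))))"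

text \<open>The Hodge map of \<open>\<Omega>(S\<^sup>2\<^sub>q)\<close>, which consists of the forms
  \<open>x0 + xm \<omega>\<^sub>- + xp \<omega>\<^sub>+ + xmp \<omega>\<^sub>-\<and>\<omega>\<^sub>+\<close> with \<open>x0, xmp \<in> L 0\<close>, \<open>xm \<in> L (- 2)\<close>, \<open>xp \<in> L 2\<close>; on other
  forms its value is irrelevant. The last term is the
  value \<open>\<alpha>''\<^sup>-\<^sup>1\<close> at \<open>\<i> \<omega>\<^sub>-\<and>\<omega>\<^sub>+\<close>, using \<open>xmp \<omega>\<^sub>-\<and>\<omega>\<^sub>+ = (- \<i> xmp) (\<i> \<omega>\<^sub>-\<and>\<omega>\<^sub>+)\<close>.\<close>

definition hodge_S2 :: "real \<Rightarrow> 'w \<Rightarrow> 'w" where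
  "hodge_S2 \<alpha>'' w = (case inv frame_comb w of (x0, xm, xp, xz, xmp, xpz, xzm, xv) \<Rightarrow>
     \<iota> x0 * ((\<i> * complex_of_real \<alpha>'') *\<^sub>W (\<omega>m * \<omega>p))
     + \<iota> xm * ((\<i> * complex_of_real (\<bar>\<alpha>''\<bar> / \<alpha>'')) *\<^sub>W \<omega>m)
     + \<iota> xp * ((- \<i> * complex_of_real (\<bar>\<alpha>''\<bar> / \<alpha>'')) *\<^sub>W \<omega>p)
     + \<iota> (- \<i> *\<^sub>A xmp) * (complex_of_real (inverse \<alpha>'') *\<^sub>W 1))"

definition beta_coeff :: "nat \<Rightarrow> nat \<Rightarrow> real" where
  "beta_coeff n \<mu> = (if \<mu> = 0 then 1 else
     q ^ (2 * \<mu>) * (\<Prod>j<\<mu>. (1 - q powi (- 2 * (int n - int j))) / (1 - q powi (- 2 * (int j + 1)))))"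

definition alpha_coeff :: "nat \<Rightarrow> nat \<Rightarrow> real" where
  "alpha_coeff m \<mu> = (if \<mu> = 0 then 1 else
     (\<Prod>j<m - \<mu>. (1 - q ^ (2 * (m - j))) / (1 - q ^ (2 * (j + 1)))))"

text \<open>The column \<open>Psi n\<close> has the entries \<open>Psi n \<mu>\<close> for \<open>\<mu> \<le> nat \<bar>n\<bar>\<close>; all rows and columns below
  are likewise indexed by \<open>{..nat \<bar>n\<bar>}\<close>.\<close>

definition Psi :: "int \<Rightarrow> nat \<Rightarrow> 'a" where
  "Psi n \<mu> = (if n \<ge> 0
     then complex_of_real (sqrt (beta_coeff (nat n) \<mu>)) *\<^sub>A (star c ^ \<mu> * star a ^ (nat n - \<mu>))
     else complex_of_real (sqrt (alpha_coeff (nat \<bar>n\<bar>) \<mu>)) *\<^sub>A (c ^ (nat \<bar>n\<bar> - \<mu>) * a ^ \<mu>))"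

definition proj :: "int \<Rightarrow> nat \<Rightarrow> nat \<Rightarrow> 'a" where
  "proj n \<mu> \<kappa> = Psi n \<mu> * star (Psi n \<kappa>)"

definition sect :: "int \<Rightarrow> 'a \<Rightarrow> nat \<Rightarrow> 'w" where
  "sect n \<phi> = (\<lambda>\<mu>. \<iota> (\<phi> * star (Psi n \<mu>)))"

definition nabla0 :: "int \<Rightarrow> (nat \<Rightarrow> 'w) \<Rightarrow> nat \<Rightarrow> 'w" where
  "nabla0 n \<sigma> = (\<lambda>\<kappa>. \<Sum>\<mu>\<le>nat \<bar>n\<bar>. d (\<sigma> \<mu>) * \<iota> (proj n \<mu> \<kappa>))"

definition pair_Psi :: "int \<Rightarrow> (nat \<Rightarrow> 'w) \<Rightarrow> 'w" where
  "pair_Psi n \<sigma> = (\<Sum>\<mu>\<le>nat \<bar>n\<bar>. \<sigma> \<mu> * \<iota> (Psi n \<mu>))"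

definition box_D0 :: "real \<Rightarrow> int \<Rightarrow> 'a \<Rightarrow> 'a" where
  "box_D0 \<alpha>'' n \<phi> = inv \<iota> (pair_Psi n
     (hodge_S2 \<alpha>'' \<circ> nabla0 n (hodge_S2 \<alpha>'' \<circ> nabla0 n (sect n \<phi>))))"

end

end

theory Submission
  imports Defs
begin

text \<open>Both Laplacians reduce to the same second-order operator in \<open>Xp\<close> and \<open>Xm\<close>.

  On the quantum group, the two-forms \<open>\<omega>m \<and> \<omega>p\<close>, \<open>\<omega>p \<and> \<omega>z\<close>, \<open>\<omega>z \<and> \<omega>m\<close> are closed, so \<open>d \<star> d x\<close> only
  differentiates coefficients and \<open>box_SU x = - (\<beta> Xp Xm x + \<nu> Xm Xp x + \<gamma> Xz Xz x)\<close>
  (lemma \<open>box_SU_eq\<close>). Adding \<open>\<gamma> Xz Xz x\<close> removes the vertical part.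

  For the gauged Laplacian, \<open>Xp\<close> and \<open>Xm\<close> are twisted derivations, \<open>D (x y) = D x \<cdot> K\<^sup>2 y + x \<cdot> D y\<close>, and \<open>K\<^sup>2\<close>
  acts on the weight space \<open>L n\<close> as \<open>q\<^sup>n\<close>. In the covariant derivative of \<open>x \<langle>\<Psi>|\<close> one meets
  \<open>\<Sum>\<mu>. D (x \<Psi>*\<^sub>\<mu>) \<Psi>\<^sub>\<mu> = q\<^sup>-\<^sup>n D x \<cdot> \<langle>\<Psi>|\<Psi>\<rangle> + x \<cdot> \<Sum>\<mu>. D (\<Psi>*\<^sub>\<mu>) \<Psi>\<^sub>\<mu>\<close>. Here \<open>\<langle>\<Psi>|\<Psi>\<rangle> = 1\<close>
  (lemma \<open>Psi_normalised\<close>), and the last sum vanishes: the entries of \<open>\<Psi>\<close> are highest or lowest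
  weight vectors, so \<open>D\<close> kills either all \<open>\<Psi>*\<^sub>\<mu>\<close>, or all \<open>\<Psi>\<^sub>\<mu>\<close>, and in the latter case the sum is
  a multiple of \<open>D \<langle>\<Psi>|\<Psi>\<rangle> = D 1 = 0\<close> (lemma \<open>sum_derivation_Psi\<close>). Hence the gauged derivative of a
  section acts on its coefficient function as \<open>q\<^sup>-\<^sup>n Xp\<close>, \<open>q\<^sup>-\<^sup>n Xm\<close>, and two derivatives give
  \<open>q\<^sup>2\<^sup>n box_D0 x = - |\<alpha>''|\<^sup>-\<^sup>1 (q\<^sup>2 Xp Xm x + Xm Xp x)\<close> (lemma \<open>box_D0_eq\<close>), which is the
  \<open>Xp\<close>, \<open>Xm\<close> part of \<open>box_SU x\<close> when \<open>\<nu> = |\<alpha>''|\<^sup>-\<^sup>1\<close> and \<open>\<beta> = q\<^sup>2 \<nu>\<close>.\<close>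

section \<open>Gaussian binomial coefficients\<close>

definition gauss_binomial :: "real \<Rightarrow> nat \<Rightarrow> nat \<Rightarrow> real" where
  "gauss_binomial r m k = (\<Prod>j<k. (1 - r ^ (m - j)) / (1 - r ^ (j + 1)))"

lemma gauss_binomial_0 [simp]: "gauss_binomial r m 0 = 1"
  by (simp add: gauss_binomial_def)

lemma gauss_binomial_eq_0: "m < k \<Longrightarrow> gauss_binomial r m k = 0"
  unfolding gauss_binomial_def by (rule prod_zero) (auto intro!: bexI[of _ m])

lemma gauss_binomial_nonneg:
  assumes "r > 0"
  shows "gauss_binomial r m k \<ge> 0"
  unfolding gauss_binomial_def
proof (intro prod_nonneg)
  fix j
  show "(1 - r ^ (m - j)) / (1 - r ^ (j + 1)) \<ge> 0"
  proof (cases "r \<le> 1")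
    case True
    with assms have "r ^ i \<le> 1" for i by (simp add: power_le_one)
    then show ?thesis by (intro divide_nonneg_nonneg) (simp_all del: power_Suc)
  next
    case False
    then have "r ^ i \<ge> 1" for i by simp
    then show ?thesis by (intro divide_nonpos_nonpos) (simp_all del: power_Suc)
  qed
qed

lemma gauss_binomial_Suc_Suc:
  assumes "r > 0" "r \<noteq> 1"
  shows "gauss_binomial r (Suc m) (Suc k)
    = r ^ Suc k * gauss_binomial r m (Suc k) + gauss_binomial r m k"
proof (cases "k \<le> m")
  case True
  have nz: "1 - r ^ Suc j \<noteq> 0" for j
    using assms power_eq_iff_eq_base[of "Suc j" r 1] by simp
  have "gauss_binomial r (Suc m) (Suc k)
      = (\<Prod>j<Suc k. 1 - r ^ (Suc m - j)) / (\<Prod>j<Suc k. 1 - r ^ Suc j)"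
    by (simp add: gauss_binomial_def prod_dividef)
  also have "(\<Prod>j<Suc k. 1 - r ^ (Suc m - j)) = (1 - r ^ Suc m) * (\<Prod>j<k. 1 - r ^ (m - j))"
    by (subst prod.lessThan_Suc_shift) (simp only: diff_zero diff_Suc_Suc)
  finally have shift: "gauss_binomial r (Suc m) (Suc k)
      = gauss_binomial r m k * ((1 - r ^ Suc m) / (1 - r ^ Suc k))"
    by (simp only: gauss_binomial_def prod_dividef Suc_eq_plus1 times_divide_times_eq mult_ac)
       (simp only: Suc_eq_plus1[symmetric] prod.lessThan_Suc mult_ac)
  have step: "gauss_binomial r m (Suc k) = gauss_binomial r m k * ((1 - r ^ (m - k)) / (1 - r ^ Suc k))"
    by (simp add: gauss_binomial_def)
  have "r ^ Suc k * (1 - r ^ (m - k)) + (1 - r ^ Suc k) = 1 - r ^ Suc m"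
    using True by (simp add: algebra_simps flip: power_add)
  then have "r ^ Suc k * ((1 - r ^ (m - k)) / (1 - r ^ Suc k)) + 1 = (1 - r ^ Suc m) / (1 - r ^ Suc k)"
    using nz[of k] by (simp add: field_simps)
  then show ?thesis
    unfolding shift step by (metis (no_types, lifting) distrib_left mult.left_commute mult.right_neutral)
qed (simp add: gauss_binomial_eq_0)

section \<open>A q-binomial resolution of unity\<close>

context complex_algebra
begin

lemma power_skew_commute:
  assumes "v * u = scale s (u * v)"
  shows "v ^ k * u = scale (s ^ k) (u * v ^ k)"
proof (induction k)
  case (Suc k)
  have "v ^ Suc k * u = v * (v ^ k * u)" by (simp add: mult.assoc)
  also have "\<dots> = scale (s ^ k) (v * u * v ^ k)"
    by (simp add: Suc scale_mult_right mult.assoc)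
  also have "\<dots> = scale (s ^ Suc k) (u * v ^ Suc k)"
    by (simp add: assms scale_mult_left mult.assoc mult.commute)
  finally show ?case .
qed simp

lemma skew_commute_power:
  assumes "u * v = scale s (v * u)"
  shows "u * v ^ k = scale (s ^ k) (v ^ k * u)"
proof (induction k)
  case (Suc k)
  have "u * v ^ Suc k = (u * v ^ k) * v" by (simp add: power_Suc2 mult.assoc del: power_Suc)
  also have "\<dots> = scale (s ^ k) (v ^ k * (u * v))"
    by (simp add: Suc scale_mult_left mult.assoc)
  also have "\<dots> = scale (s ^ Suc k) (v ^ Suc k * u)"
    by (simp add: assms scale_mult_right power_Suc2 mult.assoc mult.commute del: power_Suc)
  finally show ?case .
qed simp

text \<open>Inserting \<open>1 = u u' + w v v'\<close> in the middle of every summand and moving the inner \<open>u\<close>, \<open>u'\<close>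
  outwards turns the identity for \<open>m\<close> into the one for \<open>Suc m\<close>; the recursion required of \<open>C\<close> is
  what the coefficients must satisfy for this. It covers \<open>\<langle>\<Psi>|\<Psi>\<rangle> = 1\<close> for both signs of the charge,
  with \<open>(u, v) = (a, c)\<close> and \<open>(u, v) = (a*, c*)\<close>.\<close>

lemma q_binomial_resolution_of_unity:
  assumes vu: "v * u = scale s (u * v)" and uv': "u' * v' = scale s (v' * u')"
    and unit: "u * u' + scale w (v * v') = 1"
    and C0: "\<And>m. C m 0 = 1" and C_large: "\<And>m k. m < k \<Longrightarrow> C m k = 0"
    and C_Suc: "\<And>m k. C (Suc m) (Suc k) = s ^ (2 * Suc k) * C m (Suc k) + w * C m k"
  shows "(\<Sum>k\<le>m. scale (C m k) (u ^ (m - k) * v ^ k * v' ^ k * u' ^ (m - k))) = 1"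
proof (induction m)
  case 0
  then show ?case by (simp add: C0)
next
  case (Suc m)
  define M where "M i k = u ^ i * v ^ k * v' ^ k * u' ^ i" for i k
  have insert_unit: "M i k = scale (s ^ (2 * k)) (M (Suc i) k) + scale w (M i (Suc k))" for i k
  proof -
    have "M i k = u ^ i * v ^ k * (u * u' + scale w (v * v')) * v' ^ k * u' ^ i"
      by (simp add: unit M_def)
    also have "\<dots> = u ^ i * (v ^ k * u) * (u' * v' ^ k) * u' ^ i
        + scale w (u ^ i * (v ^ k * v) * (v' * v' ^ k) * u' ^ i)"
      by (simp add: distrib_left distrib_right scale_mult_left scale_mult_right mult.assoc)
    also have "u ^ i * (v ^ k * u) * (u' * v' ^ k) * u' ^ i = scale (s ^ (2 * k)) (M (Suc i) k)"
      unfolding power_skew_commute[OF vu] skew_commute_power[OF uv'] M_def power_Suc2[of u] power_Suc[of u']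
      by (simp add: scale_mult_left scale_mult_right mult.assoc mult_2 power_add)
    also have "u ^ i * (v ^ k * v) * (v' * v' ^ k) * u' ^ i = M i (Suc k)"
      unfolding M_def power_Suc2[of v] power_Suc[of v'] by (simp add: mult.assoc)
    finally show ?thesis .
  qed
  have "1 = (\<Sum>k\<le>m. scale (C m k) (M (m - k) k))" using Suc by (simp add: M_def)
  also have "\<dots> = (\<Sum>k\<le>m. scale (C m k * s ^ (2 * k)) (M (Suc m - k) k))
      + (\<Sum>k\<le>m. scale (C m k * w) (M (m - k) (Suc k)))"
    unfolding sum.distrib[symmetric]
  proof (rule sum.cong)
    fix k assume "k \<in> {..m}"
    then have "Suc m - k = Suc (m - k)" by auto
    then show "scale (C m k) (M (m - k) k) = scale (C m k * s ^ (2 * k)) (M (Suc m - k) k)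
        + scale (C m k * w) (M (m - k) (Suc k))"
      by (subst insert_unit) (simp add: scale_right_distrib)
  qed simp
  also have "(\<Sum>k\<le>m. scale (C m k * s ^ (2 * k)) (M (Suc m - k) k))
      = (\<Sum>k\<le>Suc m. scale (C m k * s ^ (2 * k)) (M (Suc m - k) k))"
    by (simp add: C_large)
  also have "\<dots> = M (Suc m) 0
      + (\<Sum>k\<le>m. scale (C m (Suc k) * s ^ (2 * Suc k)) (M (m - k) (Suc k)))"
    unfolding sum.atMost_Suc_shift by (simp add: C0)
  also have "M (Suc m) 0
        + (\<Sum>k\<le>m. scale (C m (Suc k) * s ^ (2 * Suc k)) (M (m - k) (Suc k)))
        + (\<Sum>k\<le>m. scale (C m k * w) (M (m - k) (Suc k)))
      = M (Suc m) 0 + (\<Sum>k\<le>m. scale (C (Suc m) (Suc k)) (M (m - k) (Suc k)))"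
    unfolding add.assoc sum.distrib[symmetric] scale_left_distrib[symmetric] C_Suc
    by (simp add: mult.commute)
  also have "\<dots> = (\<Sum>k\<le>Suc m. scale (C (Suc m) k) (M (Suc m - k) k))"
    unfolding sum.atMost_Suc_shift by (simp add: C0)
  finally show ?case by (simp only: M_def)
qed

end

section \<open>Normalisation of the line bundle frames\<close>

context suq2_algebra
begin

lemma generators_induct [case_names zero one add scale letter]:
  assumes "P 0" "P 1" "\<And>x y. P x \<Longrightarrow> P y \<Longrightarrow> P (x + y)" "\<And>z x. P x \<Longrightarrow> P (z *\<^sub>A x)"
    and "\<And>l x. P x \<Longrightarrow> P (letter_val l * x)"
  shows "P x"
proof -
  have word: "P (prod_list (map letter_val ls))" for ls
    by (induction ls) (use assms in auto)
  obtain p where "x = eval_free p" using generated by blast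
  moreover have "P (\<Sum>w\<in>A. Poly_Mapping.lookup p w *\<^sub>A prod_list (map letter_val (letters w)))"
    if "finite A" for A
    using that by induction (use assms word in auto)
  ultimately show ?thesis by (simp add: eval_free_def)
qed

lemma adj_one [simp]: "star 1 = 1"
  by (metis adj_adj adj_mult mult.left_neutral mult.right_neutral)

lemma adj_power: "star (x ^ k) = star x ^ k"
  by (induction k) (simp_all add: adj_mult power_commutes)

lemma cs_as: "star c * star a = complex_of_real q *\<^sub>A (star a * star c)"
  using arg_cong[OF relations(1), of star] by (simp add: adj_mult adj_scale)

lemma c_a: "c * a = complex_of_real (1 / q) *\<^sub>A (a * c)"
  using q_pos by (simp add: relations(1) flip: of_real_mult)

lemma as_cs: "star a * star c = complex_of_real (1 / q) *\<^sub>A (star c * star a)"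
  using q_pos by (simp add: cs_as flip: of_real_mult)

text \<open>The base is \<open>q\<^sup>-\<^sup>2\<close>, so that the recursion of the Gaussian binomials produces the factor
  \<open>q\<^sup>-\<^sup>2\<^sup>k\<close> that arises from \<open>c\<^sup>k a = q\<^sup>-\<^sup>k a c\<^sup>k\<close> and its adjoint.\<close>

lemma beta_coeff_eq: "beta_coeff m k = q ^ (2 * k) * gauss_binomial (1 / q\<^sup>2) m k" if "k \<le> m"
proof -
  have 1: "q powi (- 2 * (int m - int j)) = (1 / q\<^sup>2) ^ (m - j)" if "j < k" for j
  proof -
    have "- 2 * (int m - int j) = - int (2 * (m - j))" using that \<open>k \<le> m\<close> by simp
    then show ?thesis
      by (simp only: power_int_minus power_int_of_nat)
         (simp only: power_mult power_one_over inverse_eq_divide)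
  qed
  have 2: "q powi (- 2 * (int j + 1)) = (1 / q\<^sup>2) ^ (j + 1)" for j
  proof -
    have "- 2 * (int j + 1) = - int (2 * (j + 1))" by simp
    then show ?thesis
      by (simp only: power_int_minus power_int_of_nat)
         (simp only: power_mult power_one_over inverse_eq_divide)
  qed
  show ?thesis
  proof (cases "k = 0")
    case False
    then show ?thesis unfolding beta_coeff_def gauss_binomial_def
      by (simp only: if_False)
         (rule arg_cong[of _ _ "(*) _"], rule prod.cong, simp, simp only: 1 2 lessThan_iff)
  qed (simp add: beta_coeff_def)
qed

text \<open>For negative charge the exponent of \<open>c\<close> is \<open>m - \<mu>\<close>, which is therefore the natural index.
  At \<open>\<mu> = 0\<close> the coefficient is set to 1 separately; this agrees with the product, whose numerator and
  denominator then have the same factors in reverse order.\<close>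

lemma alpha_coeff_eq: "alpha_coeff m (m - k) = gauss_binomial (q\<^sup>2) m k" if "k \<le> m"
proof (cases "k = m")
  case True
  have "1 - (q\<^sup>2) ^ Suc j \<noteq> 0" for j
    using q_pos q_less_1 power_eq_iff_eq_base[of "2 * Suc j" q 1]
    by (simp flip: power_mult del: power_Suc mult_Suc_right)
  moreover have "(\<Prod>j<m. 1 - (q\<^sup>2) ^ (m - j)) = (\<Prod>j<m. 1 - (q\<^sup>2) ^ (j + 1))"
    by (subst prod.nat_diff_reindex[symmetric], rule prod.cong) (simp_all del: power_Suc add: Suc_diff_Suc)
  ultimately show ?thesis using True
    by (simp add: alpha_coeff_def gauss_binomial_def prod_dividef del: power_Suc)
next
  case False
  then show ?thesis using that
    by (simp add: alpha_coeff_def gauss_binomial_def power_mult del: power_Suc mult_Suc_right)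
qed

lemma Psi_nonneg:
  "Psi (int m) \<mu> = complex_of_real (sqrt (beta_coeff m \<mu>)) *\<^sub>A (star c ^ \<mu> * star a ^ (m - \<mu>))"
  by (simp add: Psi_def)

lemma Psi_nonpos:
  "k \<le> m \<Longrightarrow> Psi (- int m) (m - k)
    = complex_of_real (sqrt (alpha_coeff m (m - k))) *\<^sub>A (c ^ k * a ^ (m - k))"
  by (cases "m = 0") (simp_all add: Psi_def alpha_coeff_def beta_coeff_def)

lemma star_Psi_nonneg:
  "star (Psi (int m) \<mu>) = complex_of_real (sqrt (beta_coeff m \<mu>)) *\<^sub>A (a ^ (m - \<mu>) * c ^ \<mu>)"
  by (simp add: Psi_nonneg adj_scale adj_mult adj_power adj_adj)

lemma star_Psi_nonpos:
  "k \<le> m \<Longrightarrow> star (Psi (- int m) (m - k))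
    = complex_of_real (sqrt (alpha_coeff m (m - k))) *\<^sub>A (star a ^ (m - k) * star c ^ k)"
  by (simp add: Psi_nonpos adj_scale adj_mult adj_power adj_adj)

lemma Psi_normalised: "(\<Sum>\<mu>\<le>nat \<bar>n\<bar>. star (Psi n \<mu>) * Psi n \<mu>) = 1"
proof (cases n rule: int_cases2)
  case (nonneg m)
  let ?r = "1 / q\<^sup>2"
  have r: "?r > 0" "?r \<noteq> 1" using q_pos q_less_1 power_eq_iff_eq_base[of 2 q 1] by auto
  have "(\<Sum>k\<le>m. complex_of_real (q ^ (2 * k) * gauss_binomial ?r m k) *\<^sub>A
      (a ^ (m - k) * c ^ k * star c ^ k * star a ^ (m - k))) = 1"
  proof (rule q_binomial_resolution_of_unity[OF c_a as_cs relations(5)])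
    fix m k
    have "q ^ (2 * Suc k) * gauss_binomial ?r (Suc m) (Suc k)
      = (1 / q) ^ (2 * Suc k) * (q ^ (2 * Suc k) * gauss_binomial ?r m (Suc k))
      + q\<^sup>2 * (q ^ (2 * k) * gauss_binomial ?r m k)"
      using q_pos unfolding gauss_binomial_Suc_Suc[OF r]
      by (simp add: power_mult power_one_over distrib_left power2_eq_square)
    from arg_cong[OF this, of complex_of_real]
    show "complex_of_real (q ^ (2 * Suc k) * gauss_binomial ?r (Suc m) (Suc k))
      = complex_of_real (1 / q) ^ (2 * Suc k) * complex_of_real (q ^ (2 * Suc k) * gauss_binomial ?r m (Suc k))
      + complex_of_real (q\<^sup>2) * complex_of_real (q ^ (2 * k) * gauss_binomial ?r m k)"
      by (simp only: of_real_add of_real_mult of_real_power)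
  qed (simp_all add: gauss_binomial_eq_0)
  moreover have "star (Psi n k) * Psi n k = complex_of_real (q ^ (2 * k) * gauss_binomial ?r m k) *\<^sub>A
      (a ^ (m - k) * c ^ k * star c ^ k * star a ^ (m - k))" if "k \<le> m" for k
  proof -
    have "beta_coeff m k \<ge> 0"
      using q_pos r that by (simp add: beta_coeff_eq gauss_binomial_nonneg)
    then show ?thesis
      unfolding nonneg star_Psi_nonneg
      unfolding Psi_nonneg beta_coeff_eq[OF that, symmetric]
      by (simp add: scale_mult_left scale_mult_right mult.assoc flip: of_real_mult)
  qed
  ultimately show ?thesis using nonneg by simp
next
  case (nonpos m)
  let ?r = "q\<^sup>2"
  have r: "?r > 0" "?r \<noteq> 1" using q_pos q_less_1 power_eq_iff_eq_base[of 2 q 1] by auto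
  have "(\<Sum>k\<le>m. complex_of_real (gauss_binomial ?r m k) *\<^sub>A
      (star a ^ (m - k) * star c ^ k * c ^ k * a ^ (m - k))) = 1"
  proof (rule q_binomial_resolution_of_unity[OF cs_as relations(1), where w = 1])
    fix m k
    have "gauss_binomial ?r (Suc m) (Suc k) = q ^ (2 * Suc k) * gauss_binomial ?r m (Suc k)
      + gauss_binomial ?r m k"
      unfolding gauss_binomial_Suc_Suc[OF r] by (simp only: power_mult)
    from arg_cong[OF this, of complex_of_real]
    show "complex_of_real (gauss_binomial ?r (Suc m) (Suc k))
      = complex_of_real q ^ (2 * Suc k) * complex_of_real (gauss_binomial ?r m (Suc k))
      + 1 * complex_of_real (gauss_binomial ?r m k)"
      by (simp only: of_real_add of_real_mult of_real_power mult_1)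
  qed (simp_all add: gauss_binomial_eq_0 relations(4))
  moreover have "star (Psi n (m - k)) * Psi n (m - k) = complex_of_real (gauss_binomial ?r m k) *\<^sub>A
      (star a ^ (m - k) * star c ^ k * c ^ k * a ^ (m - k))" if "k \<le> m" for k
  proof -
    have "gauss_binomial ?r m k \<ge> 0" using r by (simp add: gauss_binomial_nonneg)
    then show ?thesis
      unfolding nonpos star_Psi_nonpos[OF that]
      unfolding Psi_nonpos[OF that] alpha_coeff_eq[OF that]
      by (simp add: scale_mult_left scale_mult_right mult.assoc flip: of_real_mult)
  qed
  ultimately have "(\<Sum>k\<le>m. star (Psi n (m - k)) * Psi n (m - k)) = 1" by simp
  then show ?thesis using nonpos
    sum.nat_diff_reindex[of "\<lambda>\<mu>. star (Psi n \<mu>) * Psi n \<mu>" "Suc m"]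
    by (simp add: lessThan_Suc_atMost)
qed

end

section \<open>Weights and twisted derivations\<close>

context suq2_action
begin

interpretation K: Vector_Spaces.linear "scaleA S" "scaleA S" K by (rule K_linear)
interpretation E: Vector_Spaces.linear "scaleA S" "scaleA S" E by (rule E_linear)
interpretation F: Vector_Spaces.linear "scaleA S" "scaleA S" F by (rule F_linear)

text \<open>Used for \<open>E\<close> and \<open>F\<close>: the relations \<open>K E = q E K\<close> and \<open>K F = q\<^sup>-\<^sup>1 F K\<close> of the Hopf algebra
  hold for the action because both sides obey the same product rule and agree on generators.\<close>

lemma twisted_derivation_weight:
  assumes D: "Vector_Spaces.linear (scaleA S) (scaleA S) D"
    and mult: "\<And>x y. D (x * y) = D x * K y + Kinv x * D y" and one: "D 1 = 0"
    and letter: "\<And>l. K (D (letter_val l)) = s *\<^sub>A D (K (letter_val l))"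
  shows "K (D x) = s *\<^sub>A D (K x)"
proof -
  interpret D: Vector_Spaces.linear "scaleA S" "scaleA S" D by (rule D)
  show ?thesis
  proof (induction x rule: generators_induct)
    case (letter l x)
    have "K (D (letter_val l * x)) = K (D (letter_val l)) * K (K x) + letter_val l * K (D x)"
      by (simp add: mult K.add K_mult K_Kinv)
    also have "\<dots> = s *\<^sub>A (D (K (letter_val l)) * K (K x) + letter_val l * D (K x))"
      by (simp add: assms(4) letter scale_mult_left scale_mult_right scale_right_distrib)
    also have "\<dots> = s *\<^sub>A D (K (letter_val l * x))"
      by (simp add: mult K_mult Kinv_K)
    finally show ?case .
  qed (simp_all add: one K_one D.zero K.zero D.add K.add D.scale K.scale scale_right_distrib
      scale_left_commute)
qed

lemma q_powr_half: "q powr (1 / 2) = q * q powr (- 1 / 2)" "q powr (- (1 / 2)) = q powr (1 / 2) / q"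
  using powr_add[of q 1 "- 1 / 2"] powr_add[of q "1 / 2" "- 1"] q_pos
  by (simp_all add: powr_minus_divide)

lemma K_E: "K (E x) = complex_of_real q *\<^sub>A E (K x)"
proof (rule twisted_derivation_weight[OF E_linear E_mult E_one])
  show "K (E (letter_val l)) = complex_of_real q *\<^sub>A E (K (letter_val l))" for l
    by (cases l) (simp_all add: E_a E_c E_as E_cs K_a K_c K_as K_cs K.scale E.scale K.zero
        K.neg E.neg q_powr_half(1) mult_ac)
qed

lemma K_F: "K (F x) = complex_of_real (1 / q) *\<^sub>A F (K x)"
proof (rule twisted_derivation_weight[OF F_linear F_mult F_one])
  show "K (F (letter_val l)) = complex_of_real (1 / q) *\<^sub>A F (K (letter_val l))" for l
    by (cases l) (simp_all add: F_a F_c F_as F_cs K_a K_c K_as K_cs K.scale F.scale K.zero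
        K.neg F.neg q_powr_half(2) mult_ac)
qed

lemma weightI: "K x = complex_of_real (q powr (real_of_int n / 2)) *\<^sub>A x \<Longrightarrow> x \<in> L n"
  by (simp add: L_def)

lemma weightD: "x \<in> L n \<Longrightarrow> K x = complex_of_real (q powr (real_of_int n / 2)) *\<^sub>A x"
  by (simp add: L_def)

lemma L_mult: "x \<in> L m \<Longrightarrow> y \<in> L n \<Longrightarrow> x * y \<in> L (m + n)"
  by (rule weightI) (simp add: K_mult weightD scale_mult_left scale_mult_right add_divide_distrib powr_add
      mult.commute flip: of_real_mult)

lemma L_scale: "x \<in> L n \<Longrightarrow> z *\<^sub>A x \<in> L n"
  by (rule weightI) (simp add: K.scale weightD scale_left_commute)

lemma L_one: "1 \<in> L 0"
  using q_pos by (intro weightI) (simp add: K_one)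

lemma L_power: "x \<in> L n \<Longrightarrow> x ^ k \<in> L (int k * n)"
proof (induction k)
  case (Suc k)
  then show ?case using L_mult[of x n "x ^ k" "int k * n"] by (simp add: algebra_simps)
qed (simp add: L_one)

lemma weight_generators: "a \<in> L (- 1)" "c \<in> L (- 1)" "star a \<in> L 1" "star c \<in> L 1"
  by (auto intro!: weightI simp: K_a K_c K_as K_cs)

lemma Psi_weight:
  assumes "\<mu> \<le> nat \<bar>n\<bar>"
  shows "Psi n \<mu> \<in> L n" "star (Psi n \<mu>) \<in> L (- n)"
proof -
  have "Psi n \<mu> \<in> L n \<and> star (Psi n \<mu>) \<in> L (- n)"
  proof (cases n rule: int_cases2)
    case (nonneg m)
    with assms have "\<mu> \<le> m" by simp
    then show ?thesis unfolding nonneg star_Psi_nonneg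
      using L_mult[OF weight_generators(4,3)[THEN L_power], of \<mu> "m - \<mu>"]
        L_mult[OF weight_generators(1,2)[THEN L_power], of "m - \<mu>" \<mu>]
      by (simp add: Psi_nonneg L_scale of_nat_diff)
  next
    case (nonpos m)
    define k where "k = m - \<mu>"
    with nonpos assms have k: "k \<le> m" "\<mu> = m - k" by simp_all
    then show ?thesis unfolding nonpos k(2) star_Psi_nonpos[OF k(1)]
      using L_mult[OF weight_generators(2,1)[THEN L_power], of k "m - k"]
        L_mult[OF weight_generators(3,4)[THEN L_power], of "m - k" k]
      by (simp add: Psi_nonpos L_scale of_nat_diff)
  qed
  then show "Psi n \<mu> \<in> L n" "star (Psi n \<mu>) \<in> L (- n)" by simp_all
qed

lemma K_K: "x \<in> L n \<Longrightarrow> K (K x) = complex_of_real (q powi n) *\<^sub>A x"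
  using q_pos by (simp add: weightD K.scale powr_real_of_int' flip: of_real_mult powr_add)

lemma Xz_weight:
  assumes "x \<in> L n"
  shows "Xz x = complex_of_real ((1 - q powi (2 * n)) / (1 - q powi (- 2))) *\<^sub>A x"
proof -
  have "K (K (K (K x))) = complex_of_real (q powi (2 * n)) *\<^sub>A x"
    using assms q_pos power_int_add[of q n n] by (simp add: K_K K.scale)
  then have "x - K (K (K (K x))) = complex_of_real (1 - q powi (2 * n)) *\<^sub>A x"
    by (simp add: scale_left_diff_distrib)
  then show ?thesis by (simp add: Xz_def)
qed

lemma Xp_weight: "x \<in> L n \<Longrightarrow> Xp x \<in> L (n + 2)"
proof -
  assume x: "x \<in> L n"
  have "E x \<in> L (n + 2)"
    using q_pos by (intro weightI) (simp add: K_E weightD[OF x] E.scale add_divide_distrib powr_add mult.commute)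
  then show "Xp x \<in> L (n + 2)" by (simp add: Xp_def weightD[OF x] E.scale L_scale)
qed

lemma Xm_weight: "x \<in> L n \<Longrightarrow> Xm x \<in> L (n - 2)"
proof -
  assume x: "x \<in> L n"
  have "F x \<in> L (n - 2)"
    using q_pos by (intro weightI) (simp add: K_F weightD[OF x] F.scale diff_divide_distrib powr_diff mult.commute)
  then show "Xm x \<in> L (n - 2)" by (simp add: Xm_def weightD[OF x] F.scale L_scale)
qed

lemma Xp_linear: "Xp (x + y) = Xp x + Xp y" "Xp (z *\<^sub>A x) = z *\<^sub>A Xp x"
  by (simp_all add: Xp_def K.add K.scale E.add E.scale scale_right_distrib mult.commute)

lemma Xm_linear: "Xm (x + y) = Xm x + Xm y" "Xm (z *\<^sub>A x) = z *\<^sub>A Xm x"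
  by (simp_all add: Xm_def K.add K.scale F.add F.scale scale_right_distrib mult.commute)

lemma Xz_scale: "Xz (z *\<^sub>A x) = z *\<^sub>A Xz x"
  by (simp add: Xz_def K.scale mult.commute flip: scale_right_diff_distrib)

text \<open>The factor \<open>K\<close> in \<open>Xp\<close> cancels the \<open>K\<^sup>-\<^sup>1\<close> of the coproduct, so that only the first term is
  twisted.\<close>

lemma Xp_mult: "Xp (x * y) = Xp x * K (K y) + x * Xp y"
  by (simp add: Xp_def K_mult E_mult Kinv_K scale_mult_left scale_mult_right scale_right_distrib)

lemma Xm_mult: "Xm (x * y) = Xm x * K (K y) + x * Xm y"
  by (simp add: Xm_def K_mult F_mult Kinv_K scale_mult_left scale_mult_right scale_right_distrib)

lemma Xp_one: "Xp 1 = 0" and Xm_one: "Xm 1 = 0"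
  by (simp_all add: Xp_def Xm_def K_one E_one F_one)

lemma Xp_star_generators: "Xp (star a) = 0" "Xp (star c) = 0"
  by (simp_all add: Xp_def K_as K_cs E.scale E_as E_cs)

lemma Xm_generators: "Xm a = 0" "Xm c = 0"
  by (simp_all add: Xm_def K_a K_c F.scale F_a F_c)

lemma Xp_power_eq_0: "Xp x = 0 \<Longrightarrow> Xp (x ^ k) = 0"
  by (induction k) (simp_all add: Xp_one Xp_mult)

lemma Xm_power_eq_0: "Xm x = 0 \<Longrightarrow> Xm (x ^ k) = 0"
  by (induction k) (simp_all add: Xm_one Xm_mult)

text \<open>For \<open>n \<ge> 0\<close> the entries of \<open>\<Psi>\<close> are words in \<open>a*, c*\<close>, which \<open>Xp\<close> kills, and their adjoints are
  words in \<open>a, c\<close>, which \<open>Xm\<close> kills; for \<open>n \<le> 0\<close> the roles are exchanged.\<close>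

lemma Psi_extremal:
  "(\<forall>\<mu>\<le>nat \<bar>n\<bar>. Xp (Psi n \<mu>) = 0 \<and> Xm (star (Psi n \<mu>)) = 0) \<or>
   (\<forall>\<mu>\<le>nat \<bar>n\<bar>. Xm (Psi n \<mu>) = 0 \<and> Xp (star (Psi n \<mu>)) = 0)"
proof (cases n rule: int_cases2)
  case (nonneg m)
  have "Xp (Psi n \<mu>) = 0 \<and> Xm (star (Psi n \<mu>)) = 0" for \<mu>
    unfolding nonneg star_Psi_nonneg
    by (simp add: Psi_nonneg Xp_linear Xm_linear Xp_mult Xm_mult Xp_power_eq_0 Xm_power_eq_0 Xp_star_generators Xm_generators)
  then show ?thesis by blast
next
  case (nonpos m)
  have "Xm (Psi n \<mu>) = 0 \<and> Xp (star (Psi n \<mu>)) = 0" if "\<mu> \<le> m" for \<mu>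
  proof -
    define k where "k = m - \<mu>"
    with that have k: "k \<le> m" "\<mu> = m - k" by simp_all
    then show ?thesis unfolding nonpos k(2) star_Psi_nonpos[OF k(1)]
      by (simp add: Psi_nonpos Xp_linear Xm_linear Xp_mult Xm_mult Xp_power_eq_0 Xm_power_eq_0 Xp_star_generators Xm_generators)
  qed
  then show ?thesis using nonpos by simp
qed

text \<open>The monopole connection acts on coefficient functions as \<open>D\<close> itself, up to the factor
  \<open>q\<^sup>-\<^sup>n\<close> by which \<open>K\<^sup>2\<close> acts on \<open>\<Psi>*\<close>: the gauge potential \<open>\<Sum>\<mu>. D (\<Psi>*\<^sub>\<mu>) \<Psi>\<^sub>\<mu>\<close> vanishes.\<close>

lemma sum_derivation_Psi:
  assumes add: "\<And>x y. D (x + y) = D x + D y" and mult: "\<And>x y. D (x * y) = D x * K (K y) + x * D y"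
    and one: "D 1 = 0"
    and extremal: "(\<forall>\<mu>\<le>nat \<bar>n\<bar>. D (Psi n \<mu>) = 0) \<or> (\<forall>\<mu>\<le>nat \<bar>n\<bar>. D (star (Psi n \<mu>)) = 0)"
  shows "(\<Sum>\<mu>\<le>nat \<bar>n\<bar>. D (x * star (Psi n \<mu>)) * Psi n \<mu>) = complex_of_real (q powi (- n)) *\<^sub>A D x"
proof -
  have "D 0 = 0" using add[of 0 0] by simp
  have D_sum: "D (sum f A) = (\<Sum>i\<in>A. D (f i))" if "finite A" for f and A :: "nat set"
    using that by induction (simp_all add: add \<open>D 0 = 0\<close>)
  have vanish: "(\<Sum>\<mu>\<le>nat \<bar>n\<bar>. D (star (Psi n \<mu>)) * Psi n \<mu>) = 0"
    using extremal
  proof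
    assume 0: "\<forall>\<mu>\<le>nat \<bar>n\<bar>. D (Psi n \<mu>) = 0"
    have "0 = D (\<Sum>\<mu>\<le>nat \<bar>n\<bar>. star (Psi n \<mu>) * Psi n \<mu>)"
      by (simp add: Psi_normalised one)
    also have "\<dots> = (\<Sum>\<mu>\<le>nat \<bar>n\<bar>. complex_of_real (q powi n) *\<^sub>A (D (star (Psi n \<mu>)) * Psi n \<mu>))"
      unfolding D_sum[OF finite_atMost]
      by (intro sum.cong) (simp_all add: mult 0 K_K[OF Psi_weight(1)] scale_mult_right)
    finally show ?thesis using q_pos
      by (simp flip: scale_sum_right)
  qed simp
  have "(\<Sum>\<mu>\<le>nat \<bar>n\<bar>. D (x * star (Psi n \<mu>)) * Psi n \<mu>)
      = (\<Sum>\<mu>\<le>nat \<bar>n\<bar>. complex_of_real (q powi (- n)) *\<^sub>A (D x * (star (Psi n \<mu>) * Psi n \<mu>))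
          + x * (D (star (Psi n \<mu>)) * Psi n \<mu>))"
    by (intro sum.cong) (simp_all add: mult K_K[OF Psi_weight(2)] scale_mult_right scale_mult_left
        distrib_right mult.assoc)
  also have "\<dots> = complex_of_real (q powi (- n)) *\<^sub>A (D x * (\<Sum>\<mu>\<le>nat \<bar>n\<bar>. star (Psi n \<mu>) * Psi n \<mu>))
      + x * (\<Sum>\<mu>\<le>nat \<bar>n\<bar>. D (star (Psi n \<mu>)) * Psi n \<mu>)"
    by (simp only: sum.distrib scale_sum_right sum_distrib_left)
  finally show ?thesis by (simp add: Psi_normalised vanish)
qed

lemma sum_Xp_Psi: "(\<Sum>\<mu>\<le>nat \<bar>n\<bar>. Xp (x * star (Psi n \<mu>)) * Psi n \<mu>) = complex_of_real (q powi (- n)) *\<^sub>A Xp x"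
  by (rule sum_derivation_Psi[OF Xp_linear(1) Xp_mult Xp_one]) (use Psi_extremal[of n] in blast)

lemma sum_Xm_Psi: "(\<Sum>\<mu>\<le>nat \<bar>n\<bar>. Xm (x * star (Psi n \<mu>)) * Psi n \<mu>) = complex_of_real (q powi (- n)) *\<^sub>A Xm x"
  by (rule sum_derivation_Psi[OF Xm_linear(1) Xm_mult Xm_one]) (use Psi_extremal[of n] in blast)

end

section \<open>The Laplacian of the three-dimensional calculus\<close>

context suq2_calculus
begin

interpretation \<iota>: Vector_Spaces.linear "scaleA S" "scaleW S" \<iota> by (rule emb_linear)
interpretation d: Vector_Spaces.linear "scaleW S" "scaleW S" d by (rule d_linear)

lemma frame_comb_eq_iff: "frame_comb s = frame_comb t \<longleftrightarrow> s = t"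
  using free by (auto simp: bij_def inj_eq)

lemma inv_frame_comb: "inv frame_comb (frame_comb t) = t"
  using free by (simp add: bij_def)

lemma emb_eq_frame_comb: "\<iota> x = frame_comb (x, 0, 0, 0, 0, 0, 0, 0)"
  by (simp add: frame_comb_def \<iota>.zero)

lemma inv_emb: "inv \<iota> (\<iota> x) = x"
proof -
  have "inj \<iota>" by (rule injI) (simp add: emb_eq_frame_comb frame_comb_eq_iff)
  then show ?thesis by simp
qed

lemma basis_one_forms: "\<omega>m \<in> forms 1" "\<omega>p \<in> forms 1" "\<omega>z \<in> forms 1"
proof -
  have "\<omega>m = frame_comb (0, 1, 0, 0, 0, 0, 0, 0)" "\<omega>p = frame_comb (0, 0, 1, 0, 0, 0, 0, 0)"
      "\<omega>z = frame_comb (0, 0, 0, 1, 0, 0, 0, 0)"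
    by (simp_all add: frame_comb_def \<iota>.zero emb_one)
  then show "\<omega>m \<in> forms 1" "\<omega>p \<in> forms 1" "\<omega>z \<in> forms 1"
    unfolding forms_def by fastforce+
qed

lemma emb_forms: "\<iota> x \<in> forms 0"
  unfolding forms_def emb_eq_frame_comb by fastforce

lemma d_emb_mult: "d (\<iota> x * w) = d (\<iota> x) * w + \<iota> x * d w"
  using d_Leibniz[OF emb_forms] by simp

lemma d_one_form_mult: "v \<in> forms 1 \<Longrightarrow> d (v * w) = d v * w - v * d w"
  using d_Leibniz[of v 1 w] by simp

text \<open>Oriented as rewrite rules, these bring every product of basis forms into the order
  \<open>\<omega>m, \<omega>p, \<omega>z\<close>.\<close>

lemma wedge_order:
  "\<omega>p * \<omega>m = - (complex_of_real (q\<^sup>2) *\<^sub>W (\<omega>m * \<omega>p))"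
  "\<omega>z * \<omega>m = - (complex_of_real (q ^ 4) *\<^sub>W (\<omega>m * \<omega>z))"
  "\<omega>z * \<omega>p = - (complex_of_real (1 / q ^ 4) *\<^sub>W (\<omega>p * \<omega>z))"
  "\<omega>p * (\<omega>m * w) = - (complex_of_real (q\<^sup>2) *\<^sub>W (\<omega>m * (\<omega>p * w)))"
  "\<omega>z * (\<omega>m * w) = - (complex_of_real (q ^ 4) *\<^sub>W (\<omega>m * (\<omega>z * w)))"
  "\<omega>z * (\<omega>p * w) = - (complex_of_real (1 / q ^ 4) *\<^sub>W (\<omega>p * (\<omega>z * w)))"
  "\<omega>m * \<omega>m = 0" "\<omega>p * \<omega>p = 0" "\<omega>z * \<omega>z = 0"
  "\<omega>m * (\<omega>m * w) = 0" "\<omega>p * (\<omega>p * w) = 0" "\<omega>z * (\<omega>z * w) = 0"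
proof -
  have "0 = complex_of_real (q\<^sup>2) *\<^sub>W (\<omega>m * \<omega>p + complex_of_real (q powi (- 2)) *\<^sub>W (\<omega>p * \<omega>m))"
    by (simp only: wm_wp W.scale_zero_right)
  also have "\<dots> = \<omega>p * \<omega>m + complex_of_real (q\<^sup>2) *\<^sub>W (\<omega>m * \<omega>p)"
    using q_pos by (simp add: W.scale_right_distrib power_int_minus)
  finally have pm: "\<omega>p * \<omega>m = - (complex_of_real (q\<^sup>2) *\<^sub>W (\<omega>m * \<omega>p))"
    by (simp only: eq_neg_iff_add_eq_0)
  have zm: "\<omega>z * \<omega>m = - (complex_of_real (q ^ 4) *\<^sub>W (\<omega>m * \<omega>z))"
    and zp: "\<omega>z * \<omega>p = - (complex_of_real (1 / q ^ 4) *\<^sub>W (\<omega>p * \<omega>z))"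
    using wz_wm wz_wp by (simp_all add: eq_neg_iff_add_eq_0 power_int_minus inverse_eq_divide)
  show
    "\<omega>p * \<omega>m = - (complex_of_real (q\<^sup>2) *\<^sub>W (\<omega>m * \<omega>p))"
    "\<omega>z * \<omega>m = - (complex_of_real (q ^ 4) *\<^sub>W (\<omega>m * \<omega>z))"
    "\<omega>z * \<omega>p = - (complex_of_real (1 / q ^ 4) *\<^sub>W (\<omega>p * \<omega>z))"
    "\<omega>p * (\<omega>m * w) = - (complex_of_real (q\<^sup>2) *\<^sub>W (\<omega>m * (\<omega>p * w)))"
    "\<omega>z * (\<omega>m * w) = - (complex_of_real (q ^ 4) *\<^sub>W (\<omega>m * (\<omega>z * w)))"
    "\<omega>z * (\<omega>p * w) = - (complex_of_real (1 / q ^ 4) *\<^sub>W (\<omega>p * (\<omega>z * w)))"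
    "\<omega>m * \<omega>m = 0" "\<omega>p * \<omega>p = 0" "\<omega>z * \<omega>z = 0"
    "\<omega>m * (\<omega>m * w) = 0" "\<omega>p * (\<omega>p * w) = 0" "\<omega>z * (\<omega>z * w) = 0"
    by (simp_all add: pm zm zp wm_wm wp_wp wz_wz W.scale_mult_left flip: mult.assoc)
qed

lemmas scalar_simps = W.scale_mult_left W.scale_mult_right W.scale_right_distrib
  W.scale_right_diff_distrib W.scale_minus_right W.scale_minus_left

lemma wz_wm_wp: "\<omega>z * (\<omega>m * \<omega>p) = \<omega>m * \<omega>p * \<omega>z"
  using q_pos by (simp add: wedge_order scalar_simps mult.assoc)

lemma d_basis_two_forms: "d (\<omega>m * \<omega>p) = 0" "d (\<omega>p * \<omega>z) = 0" "d (\<omega>z * \<omega>m) = 0"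
proof -
  have "d (\<omega>m * \<omega>p) = d \<omega>m * \<omega>p - \<omega>m * d \<omega>p" by (rule d_one_form_mult[OF basis_one_forms(1)])
  also have "\<dots> = complex_of_real (- (1 + 1 / q\<^sup>2) + q\<^sup>2 * (1 + q\<^sup>2) / q ^ 4) *\<^sub>W (\<omega>m * \<omega>p * \<omega>z)"
    using q_pos
    by (simp add: d_wm d_wp wedge_order scalar_simps mult.assoc W.scale_left_distrib power_int_minus inverse_eq_divide)
  also have "- (1 + 1 / q\<^sup>2) + q\<^sup>2 * (1 + q\<^sup>2) / q ^ 4 = 0"
    using q_pos by (simp add: field_simps flip: power_add)
  finally show "d (\<omega>m * \<omega>p) = 0" by simp
  show "d (\<omega>p * \<omega>z) = 0"
    by (simp add: d_one_form_mult[OF basis_one_forms(2)] d_wp d_wz wedge_order scalar_simps mult.assoc)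
  show "d (\<omega>z * \<omega>m) = 0"
    by (simp only: d_one_form_mult[OF basis_one_forms(3)])
       (simp add: d_wm d_wz wedge_order scalar_simps mult.assoc)
qed

lemma d_function: "d (frame_comb (x, 0, 0, 0, 0, 0, 0, 0)) = frame_comb (0, Xm x, Xp x, Xz x, 0, 0, 0, 0)"
  unfolding emb_eq_frame_comb[symmetric] d_emb by (simp add: frame_comb_def \<iota>.zero)

lemma d_two_form:
  "d (frame_comb (0, 0, 0, 0, x, y, z, 0))
    = frame_comb (0, 0, 0, 0, 0, 0, 0, Xz x + Xm y + complex_of_real (q ^ 6) *\<^sub>A Xp z)"
proof -
  have "d (\<iota> x * (\<omega>m * \<omega>p)) = \<iota> (Xz x) * (\<omega>m * \<omega>p * \<omega>z)"
    unfolding d_emb_mult d_basis_two_forms d_emb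
    using wz_wm_wp by (simp add: distrib_right mult.assoc wedge_order scalar_simps)
  moreover have "d (\<iota> y * (\<omega>p * \<omega>z)) = \<iota> (Xm y) * (\<omega>m * \<omega>p * \<omega>z)"
    unfolding d_emb_mult d_basis_two_forms d_emb
    by (simp add: distrib_right mult.assoc wedge_order scalar_simps)
  moreover have "d (\<iota> z * (\<omega>z * \<omega>m)) = complex_of_real (q ^ 6) *\<^sub>W (\<iota> (Xp z) * (\<omega>m * \<omega>p * \<omega>z))"
    unfolding d_emb_mult d_basis_two_forms d_emb
    using q_pos by (simp add: distrib_right mult.assoc wedge_order scalar_simps flip: power_add)
  ultimately show ?thesis
    by (simp add: frame_comb_def \<iota>.zero d.add \<iota>.add \<iota>.scale distrib_right W.scale_mult_left)
qed

text \<open>In coordinates the Hodge map reverses the frame and rescales, so the Laplacians can be computed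
  on coefficient tuples.\<close>

lemma hodge_SU_frame_comb:
  "hodge_SU \<alpha> \<beta> \<gamma> \<nu> (frame_comb (x0, xm, xp, xz, xmp, xpz, xzm, xv)) = frame_comb
    (complex_of_real (inverse \<alpha>) *\<^sub>A xv,
     complex_of_real (- (inverse \<alpha> * inverse \<beta> * q ^ 6)) *\<^sub>A xzm,
     complex_of_real (- (inverse \<alpha> * inverse \<nu>)) *\<^sub>A xpz,
     complex_of_real (- (inverse \<alpha> * inverse \<gamma>)) *\<^sub>A xmp,
     complex_of_real (- (\<alpha> * \<gamma>)) *\<^sub>A xz,
     complex_of_real (- (\<alpha> * \<nu>)) *\<^sub>A xp,
     complex_of_real (- (\<alpha> * \<beta> * q powi (- 6))) *\<^sub>A xm,
     complex_of_real \<alpha> *\<^sub>A x0)"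
  unfolding hodge_SU_def inv_frame_comb prod.case
  unfolding frame_comb_def prod.case
  by (simp only: \<iota>.scale W.scale_mult_left W.scale_mult_right mult_1_right add_ac)

lemma box_SU_eq:
  assumes "\<alpha> \<noteq> 0"
  shows "box_SU \<alpha> \<beta> \<gamma> \<nu> x
    = - (complex_of_real \<beta> *\<^sub>A Xp (Xm x) + complex_of_real \<nu> *\<^sub>A Xm (Xp x) + complex_of_real \<gamma> *\<^sub>A Xz (Xz x))"
proof -
  have "box_SU \<alpha> \<beta> \<gamma> \<nu> x = complex_of_real (inverse \<alpha>) *\<^sub>A
      (Xz (complex_of_real (- (\<alpha> * \<gamma>)) *\<^sub>A Xz x) + Xm (complex_of_real (- (\<alpha> * \<nu>)) *\<^sub>A Xp x)
        + complex_of_real (q ^ 6) *\<^sub>A Xp (complex_of_real (- (\<alpha> * \<beta> * q powi (- 6))) *\<^sub>A Xm x))"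
    unfolding box_SU_def emb_eq_frame_comb[of x] d_function hodge_SU_frame_comb scale_zero_right d_two_form
    unfolding emb_eq_frame_comb[symmetric] inv_emb ..
  also have "\<dots> = complex_of_real (inverse \<alpha> * - (\<alpha> * \<gamma>)) *\<^sub>A Xz (Xz x)
      + complex_of_real (inverse \<alpha> * - (\<alpha> * \<nu>)) *\<^sub>A Xm (Xp x)
      + complex_of_real (inverse \<alpha> * (q ^ 6 * - (\<alpha> * \<beta> * q powi (- 6)))) *\<^sub>A Xp (Xm x)"
    by (simp only: Xz_scale Xm_linear Xp_linear scale_right_distrib scale_scale of_real_mult)
  also have "\<dots> = complex_of_real (- \<gamma>) *\<^sub>A Xz (Xz x) + complex_of_real (- \<nu>) *\<^sub>A Xm (Xp x)
      + complex_of_real (- \<beta>) *\<^sub>A Xp (Xm x)"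
  proof -
    have "inverse \<alpha> * - (\<alpha> * \<gamma>) = - \<gamma>" "inverse \<alpha> * - (\<alpha> * \<nu>) = - \<nu>"
        "inverse \<alpha> * (q ^ 6 * - (\<alpha> * \<beta> * q powi (- 6))) = - \<beta>"
      using assms q_pos by (simp_all add: power_int_minus field_simps)
    then show ?thesis by (simp only:)
  qed
  finally show ?thesis by (simp add: scale_minus_left)
qed

section \<open>The gauged Laplacian on the sphere\<close>

lemma d_sphere_function: "x \<in> L 0 \<Longrightarrow> d (\<iota> x) = frame_comb (0, Xm x, Xp x, 0, 0, 0, 0, 0)"
  by (simp add: emb_eq_frame_comb d_function Xz_weight)

text \<open>On coefficients of weight \<open>\<mp>2\<close> the vertical derivative \<open>Xz\<close> is the scalar that cancels the
  contribution of \<open>d \<omega>m\<close>, respectively \<open>d \<omega>p\<close>, so no \<open>\<omega>z\<close> survives.\<close>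

lemma d_sphere_one_form:
  assumes "x \<in> L (- 2)" "y \<in> L 2"
  shows "d (frame_comb (0, x, y, 0, 0, 0, 0, 0))
    = frame_comb (0, 0, 0, 0, Xm y - complex_of_real (q\<^sup>2) *\<^sub>A Xp x, 0, 0, 0)"
proof -
  have q2: "q\<^sup>2 \<noteq> 1" "q \<noteq> 0" using q_pos q_less_1 power_eq_iff_eq_base[of 2 q 1] by auto
  have zx: "Xz x = complex_of_real (1 + q powi (- 2)) *\<^sub>A x"
  proof -
    define t where "t = 1 / q\<^sup>2"
    have "q powi (2 * - 2) = t * t" "q powi (- 2) = t"
      by (simp_all add: t_def power_int_minus inverse_eq_divide flip: power_add)
    moreover have "(1 - t * t) / (1 - t) = 1 + t"
    proof -
      have "1 - t * t = (1 - t) * (1 + t)" by (simp add: algebra_simps)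
      moreover have "1 - t \<noteq> 0" using q2 by (simp add: t_def field_simps)
      ultimately show ?thesis by simp
    qed
    ultimately show ?thesis by (simp only: Xz_weight[OF assms(1)])
  qed
  have zy: "Xz y = complex_of_real (- (q\<^sup>2 * (1 + q\<^sup>2))) *\<^sub>A y"
  proof -
    define u where "u = q\<^sup>2"
    have "q powi (2 * 2) = u * u" "q powi (- 2) = 1 / u"
      by (simp_all add: u_def power_int_minus inverse_eq_divide flip: power_add)
    moreover have "(1 - u * u) / (1 - 1 / u) = - (u * (1 + u))"
    proof -
      have "1 - u * u = - (u * (1 + u)) * (1 - 1 / u)" using q2 by (simp add: u_def field_simps)
      moreover have "1 - 1 / u \<noteq> 0" using q2 by (simp add: u_def field_simps)
      ultimately show ?thesis by simp
    qed
    ultimately show ?thesis by (simp only: Xz_weight[OF assms(2)] u_def)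
  qed
  have "d (\<iota> x * \<omega>m) = \<iota> (- complex_of_real (q\<^sup>2) *\<^sub>A Xp x) * (\<omega>m * \<omega>p)"
    unfolding d_emb_mult d_emb zx d_wm
    by (simp add: distrib_right mult.assoc \<iota>.scale \<iota>.neg scalar_simps wedge_order
        W.scale_left_distrib W.scale_left_diff_distrib distrib_left left_diff_distrib right_diff_distrib mult.commute)
  moreover have "d (\<iota> y * \<omega>p) = \<iota> (Xm y) * (\<omega>m * \<omega>p)"
    unfolding d_emb_mult d_emb zy d_wp
    by (simp add: distrib_right mult.assoc \<iota>.scale \<iota>.neg scalar_simps wedge_order left_diff_distrib)
  ultimately show ?thesis
    by (simp add: frame_comb_def \<iota>.zero d.add \<iota>.diff distrib_right left_diff_distrib scale_minus_left \<iota>.neg)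
qed

lemma hodge_S2_one_form:
  "hodge_S2 \<alpha> (frame_comb (0, x, y, 0, 0, 0, 0, 0)) = frame_comb
    (0, (\<i> * complex_of_real (\<bar>\<alpha>\<bar> / \<alpha>)) *\<^sub>A x, (- \<i> * complex_of_real (\<bar>\<alpha>\<bar> / \<alpha>)) *\<^sub>A y, 0, 0, 0, 0, 0)"
  unfolding hodge_S2_def inv_frame_comb prod.case
  unfolding frame_comb_def prod.case
  by (simp add: \<iota>.scale \<iota>.neg \<iota>.zero scale_minus_left W.scale_minus_left W.scale_mult_left
      W.scale_mult_right)

lemma hodge_S2_two_form:
  "hodge_S2 \<alpha> (frame_comb (0, 0, 0, 0, x, 0, 0, 0)) = \<iota> ((- \<i> * complex_of_real (inverse \<alpha>)) *\<^sub>A x)"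
  unfolding hodge_S2_def inv_frame_comb prod.case
  by (simp add: \<iota>.scale \<iota>.neg scale_minus_left W.scale_minus_right W.scale_mult_right mult.commute)

text \<open>Functions on the sphere have weight 0 and hence commute with \<open>\<omega>m\<close> and \<open>\<omega>p\<close>, so the projection
  acts on coefficients.\<close>

lemma sphere_form_mult:
  assumes "p \<in> L 0"
  shows "frame_comb (0, x, y, 0, z, 0, 0, 0) * \<iota> p = frame_comb (0, x * p, y * p, 0, z * p, 0, 0, 0)"
proof -
  have m: "\<omega>m * \<iota> p = \<iota> p * \<omega>m" and p: "\<omega>p * \<iota> p = \<iota> p * \<omega>p"
    using wm_comm[OF assms] wp_comm[OF assms] by simp_all
  have "\<omega>m * (\<omega>p * \<iota> p) = \<iota> p * (\<omega>m * \<omega>p)" by (simp add: p flip: mult.assoc) (simp add: m mult.assoc)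
  then show ?thesis
    by (simp add: frame_comb_def \<iota>.zero distrib_right mult.assoc emb_mult m p)
qed

lemma sum_frame_comb: "finite A \<Longrightarrow>
  (\<Sum>i\<in>A. frame_comb (0, f i, g i, 0, h i, 0, 0, 0)) = frame_comb (0, sum f A, sum g A, 0, sum h A, 0, 0, 0)"
  by (simp add: frame_comb_def \<iota>.zero \<iota>.sum sum.distrib sum_distrib_right)

lemma proj_weight: "\<mu> \<le> nat \<bar>n\<bar> \<Longrightarrow> \<kappa> \<le> nat \<bar>n\<bar> \<Longrightarrow> proj n \<mu> \<kappa> \<in> L 0"
  using L_mult[OF Psi_weight(1) Psi_weight(2), of \<mu> n \<kappa> n] by (simp add: proj_def)

lemma sum_proj:
  "(\<Sum>\<mu>\<le>nat \<bar>n\<bar>. Xp (x * star (Psi n \<mu>)) * proj n \<mu> \<kappa>) = complex_of_real (q powi (- n)) *\<^sub>A Xp x * star (Psi n \<kappa>)"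
  "(\<Sum>\<mu>\<le>nat \<bar>n\<bar>. Xm (x * star (Psi n \<mu>)) * proj n \<mu> \<kappa>) = complex_of_real (q powi (- n)) *\<^sub>A Xm x * star (Psi n \<kappa>)"
  unfolding proj_def mult.assoc[symmetric] sum_distrib_right[symmetric] sum_Xp_Psi sum_Xm_Psi
  by (rule refl)+

lemma nabla0_section:
  assumes "\<phi> \<in> L n" "\<kappa> \<le> nat \<bar>n\<bar>"
  shows "nabla0 n (sect n \<phi>) \<kappa> = frame_comb (0,
     complex_of_real (q powi (- n)) *\<^sub>A Xm \<phi> * star (Psi n \<kappa>),
     complex_of_real (q powi (- n)) *\<^sub>A Xp \<phi> * star (Psi n \<kappa>), 0, 0, 0, 0, 0)"
proof -
  have 0: "\<phi> * star (Psi n \<mu>) \<in> L 0" if "\<mu> \<le> nat \<bar>n\<bar>" for \<mu>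
    using L_mult[OF assms(1) Psi_weight(2)[OF that]] by simp
  have "nabla0 n (sect n \<phi>) \<kappa> = (\<Sum>\<mu>\<le>nat \<bar>n\<bar>. frame_comb (0, Xm (\<phi> * star (Psi n \<mu>)) * proj n \<mu> \<kappa>,
      Xp (\<phi> * star (Psi n \<mu>)) * proj n \<mu> \<kappa>, 0, 0, 0, 0, 0))"
    unfolding nabla0_def sect_def
    by (intro sum.cong) (simp_all add: d_sphere_function[OF 0] sphere_form_mult proj_weight assms)
  then show ?thesis by (simp add: sum_frame_comb sum_proj)
qed

lemma nabla0_one_form:
  assumes "x \<in> L (n - 2)" "y \<in> L (n + 2)" "\<kappa> \<le> nat \<bar>n\<bar>"
    and \<sigma>: "\<And>\<mu>. \<mu> \<le> nat \<bar>n\<bar> \<Longrightarrow> \<sigma> \<mu> = frame_comb (0, x * star (Psi n \<mu>), y * star (Psi n \<mu>), 0, 0, 0, 0, 0)"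
  shows "nabla0 n \<sigma> \<kappa> = frame_comb (0, 0, 0, 0,
     complex_of_real (q powi (- n)) *\<^sub>A (Xm y - complex_of_real (q\<^sup>2) *\<^sub>A Xp x) * star (Psi n \<kappa>), 0, 0, 0)"
proof -
  have x: "x * star (Psi n \<mu>) \<in> L (- 2)" and y: "y * star (Psi n \<mu>) \<in> L 2" if "\<mu> \<le> nat \<bar>n\<bar>" for \<mu>
    using L_mult[OF assms(1) Psi_weight(2)[OF that]] L_mult[OF assms(2) Psi_weight(2)[OF that]] by simp_all
  have "nabla0 n \<sigma> \<kappa> = (\<Sum>\<mu>\<le>nat \<bar>n\<bar>. frame_comb (0, 0, 0, 0,
      Xm (y * star (Psi n \<mu>)) * proj n \<mu> \<kappa> - complex_of_real (q\<^sup>2) *\<^sub>A (Xp (x * star (Psi n \<mu>)) * proj n \<mu> \<kappa>), 0, 0, 0))"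
    unfolding nabla0_def
    by (intro sum.cong) (simp_all add: \<sigma> d_sphere_one_form[OF x y] sphere_form_mult proj_weight assms
      left_diff_distrib scale_mult_left)
  then show ?thesis
    by (simp add: sum_frame_comb[of _ "\<lambda>_. 0" "\<lambda>_. 0", simplified] sum_subtractf sum_proj
        left_diff_distrib scale_mult_left mult.commute scale_right_diff_distrib flip: scale_sum_right)
qed

lemma box_D0_eq:
  assumes "\<phi> \<in> L n" "\<alpha> \<noteq> 0"
  shows "complex_of_real (q powi (2 * n)) *\<^sub>A box_D0 \<alpha> n \<phi>
    = - (complex_of_real (inverse \<bar>\<alpha>\<bar>) *\<^sub>A (complex_of_real (q\<^sup>2) *\<^sub>A Xp (Xm \<phi>) + Xm (Xp \<phi>)))"
proof -
  define s where "s = \<i> * complex_of_real (\<bar>\<alpha>\<bar> / \<alpha>)"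
  define r where "r = complex_of_real (q powi (- n))"
  define x where "x = (s * r) *\<^sub>A Xm \<phi>"
  define y where "y = (- s * r) *\<^sub>A Xp \<phi>"
  define \<Delta> where "\<Delta> = Xm y - complex_of_real (q\<^sup>2) *\<^sub>A Xp x"
  have x: "x \<in> L (n - 2)" and y: "y \<in> L (n + 2)"
    unfolding x_def y_def by (intro L_scale Xm_weight Xp_weight assms(1))+
  have star1: "(hodge_S2 \<alpha> \<circ> nabla0 n (sect n \<phi>)) \<mu>
      = frame_comb (0, x * star (Psi n \<mu>), y * star (Psi n \<mu>), 0, 0, 0, 0, 0)" if "\<mu> \<le> nat \<bar>n\<bar>" for \<mu>
    using assms(1) that
    by (simp add: nabla0_section hodge_S2_one_form x_def y_def s_def r_def scale_mult_left)
  have "pair_Psi n (hodge_S2 \<alpha> \<circ> nabla0 n (hodge_S2 \<alpha> \<circ> nabla0 n (sect n \<phi>)))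
      = (\<Sum>\<mu>\<le>nat \<bar>n\<bar>. \<iota> ((- \<i> * complex_of_real (inverse \<alpha>)) *\<^sub>A (r *\<^sub>A \<Delta> * (star (Psi n \<mu>) * Psi n \<mu>))))"
    unfolding pair_Psi_def
    by (intro sum.cong) (simp_all add: nabla0_one_form[OF x y _ star1] hodge_S2_two_form r_def \<Delta>_def
        emb_mult[symmetric] scale_mult_left mult.assoc)
  also have "\<dots> = \<iota> ((- \<i> * complex_of_real (inverse \<alpha>)) *\<^sub>A (r *\<^sub>A \<Delta>))"
    unfolding \<iota>.sum[symmetric] scale_sum_right[symmetric] sum_distrib_left[symmetric] Psi_normalised by simp
  finally have "box_D0 \<alpha> n \<phi> = (- \<i> * complex_of_real (inverse \<alpha>)) *\<^sub>A (r *\<^sub>A \<Delta>)"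
    by (simp only: box_D0_def inv_emb)
  also have "\<Delta> = (- s * r) *\<^sub>A (complex_of_real (q\<^sup>2) *\<^sub>A Xp (Xm \<phi>) + Xm (Xp \<phi>))"
  proof -
    have "Xm (- z) = - Xm z" for z using Xm_linear(2)[of "- 1" z] by (simp add: scale_minus_left)
    then show ?thesis
      by (simp add: \<Delta>_def x_def y_def Xm_linear Xp_linear scale_right_distrib scale_minus_left mult_ac)
  qed
  finally have "complex_of_real (q powi (2 * n)) *\<^sub>A box_D0 \<alpha> n \<phi>
      = (complex_of_real (q powi (2 * n)) * r * r * (\<i> * complex_of_real (inverse \<alpha>) * s)) *\<^sub>A
        (complex_of_real (q\<^sup>2) *\<^sub>A Xp (Xm \<phi>) + Xm (Xp \<phi>))"
    by (simp add: mult_ac)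
  also have "complex_of_real (q powi (2 * n)) * r * r = 1"
  proof -
    have "q powi (2 * n) * q powi (- n) * q powi (- n) = 1"
      using q_pos by (simp flip: power_int_add)
    then show ?thesis unfolding r_def by (metis of_real_mult of_real_1)
  qed
  \<comment> \<open>\<open>\<bar>\<alpha>\<bar> / \<alpha>\<^sup>2 = 1 / \<bar>\<alpha>\<bar>\<close>, and the two factors \<open>\<i>\<close> of the Hodge maps give the sign\<close>
  also have "\<i> * complex_of_real (inverse \<alpha>) * s = - complex_of_real (inverse \<bar>\<alpha>\<bar>)"
    using assms(2) by (cases "\<alpha> > 0") (simp_all add: s_def field_simps)
  finally show ?thesis by (simp add: scale_minus_left)
qed

end

theorem mainTheorem1:
  fixes q \<alpha>' \<alpha>'' \<beta> \<gamma> \<nu> :: real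
    and S :: "('a::ring_1, 'w::ring_1) suq2_data"
    and n :: int and \<phi> :: 'a
  assumes "0 < q" and "q < 1"
    and "suq2_calculus q S"
    and "\<alpha>' \<noteq> 0" and "\<alpha>'' \<noteq> 0"
    and "\<gamma> = \<alpha>''\<^sup>2 * \<alpha>' powi (- 2)" and "\<nu> = inverse \<bar>\<alpha>''\<bar>" and "\<beta> = q\<^sup>2 * \<nu>"
    and "\<phi> \<in> suq2_ops.L q S n"
  shows "scaleA S (complex_of_real (q powi (2 * n))) (suq2_ops.box_D0 q S \<alpha>'' n \<phi>)
    = suq2_ops.box_SU q S \<alpha>' \<beta> \<gamma> \<nu> \<phi>
      + scaleA S (complex_of_real \<gamma>) (suq2_ops.Xz q S (suq2_ops.Xz q S \<phi>))"
proof -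
  interpret suq2_calculus q S by (rule assms(3))
  show ?thesis
    unfolding box_D0_eq[OF assms(9,5)] box_SU_eq[OF assms(4)] assms(8) assms(7)
    by (simp add: scale_right_distrib mult.commute)
qed

end
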